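(* Let $r \ge 2$ and $s_r \ge \cdots \ge s_1 \ge 2$ be integers, let $s := s_1+\cdots+s_r$, and let $\mathbb{B}$ be an $r$-partite $r$-graph with part sizes $s_1,\ldots,s_r$. Then there is $n_0$ such that for every $n \ge n_0$, $$\mathrm{ex}(n,(t+1)\mathbb{B}) \le \binom{n}{r} - \binom{n-s_1(t+1)+1}{r} + \mathrm{ex}\left(n-s_1(t+1)+1,\mathbb{B}\right)$$ holds for all integers $t$ satisfying $$320 e s_1 s\left(\frac{\mathrm{ex}(n,\mathbb{B})}{\binom{n-1}{r-1}} + 320 e s_1 s^2 r!\right) \le t \le \frac{n}{512 e s_1 s^3 r!}.$$
   Context: An $r$-graph is a set of $r$-element subsets (edges) of a finite vertex set. An $r$-partite $r$-graph with part sizes $s_1,\ldots,s_r$ is an $r$-graph whose vertex set is partitioned into sets $W_1,\ldots,W_r$ with $|W_i|=s_i$ such that every edge contains exactly one vertex from each $W_i$. $\mathrm{ex}(n,F)$ denotes the maximum number of edges in an $n$-vertex $r$-graph containing no copy of $F$, and $\mathrm{ex}(n,(t+1)F)$ the maximum number of edges in an $n$-vertex $r$-graph not containing $t+1$ pairwise vertex-disjoint copies of $F$. $e$ is Euler's number. *)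

theory Defs
  imports Complex_Main
begin

definition is_rgraph :: "nat \<Rightarrow> 'a set \<Rightarrow> 'a set set \<Rightarrow> bool" where
  "is_rgraph r V E \<longleftrightarrow> finite V \<and> (\<forall>e\<in>E. e \<subseteq> V \<and> card e = r)"

definition copy_map :: "'a set \<Rightarrow> 'a set set \<Rightarrow> 'b set \<Rightarrow> 'b set set \<Rightarrow> ('a \<Rightarrow> 'b) \<Rightarrow> bool" where
  "copy_map FV FE HV HE f \<longleftrightarrow> inj_on f FV \<and> f ` FV \<subseteq> HV \<and> (\<forall>e\<in>FE. f ` e \<in> HE)"

definition has_disjoint_copies :: "nat \<Rightarrow> 'a set \<Rightarrow> 'a set set \<Rightarrow> 'b set \<Rightarrow> 'b set set \<Rightarrow> bool" where
  "has_disjoint_copies k FV FE HV HE \<longleftrightarrow>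
     (\<exists>fs :: nat \<Rightarrow> 'a \<Rightarrow> 'b. (\<forall>i<k. copy_map FV FE HV HE (fs i)) \<and>
        (\<forall>i<k. \<forall>j<k. i \<noteq> j \<longrightarrow> fs i ` FV \<inter> fs j ` FV = {}))"

text \<open>ex(n, k F): max number of edges of an n-vertex r-graph (vertex set {..<n})
  without k pairwise vertex-disjoint copies of F.  (Sup of a set of naturals;
  it equals Max whenever the set is nonempty, which it is e.g. for F with an edge.)\<close>
definition ex_mult :: "nat \<Rightarrow> nat \<Rightarrow> nat \<Rightarrow> 'a set \<Rightarrow> 'a set set \<Rightarrow> nat" where
  "ex_mult r n k FV FE = Sup {card E | E. is_rgraph r {..<n} E \<and>
        \<not> has_disjoint_copies k FV FE ({..<n}::nat set) E}"

abbreviation ex :: "nat \<Rightarrow> nat \<Rightarrow> 'a set \<Rightarrow> 'a set set \<Rightarrow> nat" where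
  "ex r n FV FE \<equiv> ex_mult r n 1 FV FE"

definition r_partite_rgraph :: "nat \<Rightarrow> (nat \<Rightarrow> nat) \<Rightarrow> (nat \<Rightarrow> 'a set) \<Rightarrow> 'a set \<Rightarrow> 'a set set \<Rightarrow> bool" where
  "r_partite_rgraph r s W V E \<longleftrightarrow>
     V = (\<Union>i\<in>{1..r}. W i) \<and>
     (\<forall>i\<in>{1..r}. finite (W i) \<and> card (W i) = s i) \<and>
     (\<forall>i\<in>{1..r}. \<forall>j\<in>{1..r}. i \<noteq> j \<longrightarrow> W i \<inter> W j = {}) \<and>
     (\<forall>e\<in>E. e \<subseteq> V \<and> (\<forall>i\<in>{1..r}. card (e \<inter> W i) = 1))"

end

theory Submission
  imports Defs
begin

text \<open>
  Write \<open>S\<close> for the number of vertices of \<open>B\<close>, \<open>D\<close> for the number of \<open>(r - 1)\<close>-subsets of the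
  vertex set and \<open>b = s\<^sub>1(t + 1) - 1\<close>. If \<open>s\<^sub>1\<close> vertices have a common link of positive density,
  then by Erdos' theorem they form the smallest part of a copy of \<open>B\<close>, whose other vertices can
  be chosen outside a prescribed small set. Averaging shows that among sufficiently many (a constant)
  vertices of degree at least \<open>\<epsilon>D\<close> there are always \<open>s\<^sub>1\<close> such vertices, so a graph without \<open>t + 1\<close>
  disjoint copies has at most \<open>s\<^sub>1t + O(1)\<close> vertices of degree at least \<open>\<epsilon>D\<close>.

  A graph that exceeds the claimed bound has nearly \<open>s\<^sub>1tD\<close> edges, and this forces many of these
  vertices to have almost full degree. Consequently the set \<open>L\<close> of vertices of degree at least
  \<open>s\<^sub>1D/(2S)\<close> can be used up completely: averaging consumes all but a bounded number of its vertices,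
  and each remaining one is completed by \<open>s\<^sub>1 - 1\<close> vertices of almost full degree. Hence \<open>|L| \<le> b\<close>,
  and with \<open>k = b - |L|\<close> the graph outside \<open>L\<close> has at most \<open>\<lfloor>k/s\<^sub>1\<rfloor>\<close> disjoint copies. All of them
  are destroyed by deleting at least \<open>k\<close> and at most \<open>kS/s\<^sub>1\<close> vertices, which loses at most \<open>kD/2\<close>
  edges, fewer than the \<open>k\<close> missing vertices of \<open>L\<close> could have contributed.
\<close>

section \<open>Complete multipartite subhypergraphs of dense hypergraphs\<close>

text \<open>Double counting of the pairs \<open>(v, x)\<close> with \<open>x \<in> A v\<close>:
  points in fewer than \<open>s\<close> of the sets cannot account for the total, so at least
  \<open>card X / card P\<close> points lie in \<open>s\<close> of them. Each of these selects an
  \<open>s\<close>-subset of \<open>P\<close>, and pigeonhole over at most \<open>2 ^ card P\<close>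
  subsets finds a popular one. The loss depends on \<open>card P\<close> only.\<close>

lemma dense_common_intersection:
  fixes A :: "'v \<Rightarrow> 'x set" and \<delta> :: real
  assumes "finite P" "P \<noteq> {}" "finite X" "X \<noteq> {}" "0 < s"
    and sub: "\<And>v. v \<in> P \<Longrightarrow> A v \<subseteq> X"
    and dense: "\<And>v. v \<in> P \<Longrightarrow> \<delta> * card X \<le> card (A v)"
    and large: "real s \<le> \<delta> * card P"
  shows "\<exists>S\<subseteq>P. card S = s \<and>
    real (card X) / (card P * 2 ^ card P) \<le> card {x \<in> X. \<forall>v\<in>S. x \<in> A v}"
proof -
  define d where "d x = card {v \<in> P. x \<in> A v}" for x
  define Y where "Y = {x \<in> X. s \<le> d x}"
  define Q where "Q = {S. S \<subseteq> P \<and> card S = s}"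
  define C where "C S = {x \<in> X. \<forall>v\<in>S. x \<in> A v}" for S
  have P0: "card P > 0" and X0: "card X > 0"
    using assms by (simp_all add: card_gt_0_iff)
  have finQ: "finite Q" and cardQ: "card Q \<le> 2 ^ card P"
  proof -
    have "Q \<subseteq> Pow P" by (auto simp: Q_def)
    then show "finite Q" "card Q \<le> 2 ^ card P"
      using \<open>finite P\<close> card_mono[of "Pow P" Q] by (auto simp: card_Pow intro: finite_subset)
  qed
  have dP: "d x \<le> card P" for x
    unfolding d_def by (rule card_mono) (use \<open>finite P\<close> in auto)
  have "(\<Sum>v\<in>P. card (A v)) = (\<Sum>v\<in>P. card {x \<in> X. x \<in> A v})"
    by (rule sum.cong) (use sub in \<open>auto intro!: arg_cong[where f = card]\<close>)
  also have "\<dots> = (\<Sum>x\<in>X. d x)"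
    unfolding d_def by (rule sum_multicount_gen) (use assms in auto)
  finally have swap: "(\<Sum>v\<in>P. card (A v)) = (\<Sum>x\<in>X. d x)" .
  have "real s * card X \<le> \<delta> * card P * card X"
    using large by (intro mult_right_mono) auto
  also have "\<dots> = (\<Sum>v\<in>P. \<delta> * card X)" by simp
  also have "\<dots> \<le> (\<Sum>v\<in>P. real (card (A v)))" by (rule sum_mono) (use dense in auto)
  also have "\<dots> = (\<Sum>x\<in>X. real (d x))" using swap by (metis of_nat_sum)
  also have "\<dots> \<le> (\<Sum>x\<in>X. (real s - 1) + (if x \<in> Y then real (card P) else 0))"
  proof (rule sum_mono)
    fix x assume x: "x \<in> X"
    show "real (d x) \<le> (real s - 1) + (if x \<in> Y then real (card P) else 0)"
      using x dP[of x] \<open>0 < s\<close> by (auto simp: Y_def)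
  qed
  also have "\<dots> = (real s - 1) * card X + real (card P) * card Y"
    using \<open>finite X\<close> by (simp add: sum.distrib sum.If_cases Y_def Int_def)
  finally have Ylarge: "real (card X) \<le> card P * card Y" by (simp add: algebra_simps)
  have "Y \<subseteq> (\<Union>S\<in>Q. C S)"
  proof
    fix x assume x: "x \<in> Y"
    then have "s \<le> card {v \<in> P. x \<in> A v}" by (simp add: Y_def d_def)
    then obtain S where "S \<subseteq> {v \<in> P. x \<in> A v}" "card S = s"
      by (rule obtain_subset_with_card_n)
    then show "x \<in> (\<Union>S\<in>Q. C S)" using x by (auto simp: Q_def C_def Y_def)
  qed
  then have "card Y \<le> card (\<Union>S\<in>Q. C S)"
    by (rule card_mono[rotated]) (use \<open>finite X\<close> finQ in \<open>auto simp: C_def\<close>)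
  also have "\<dots> \<le> (\<Sum>S\<in>Q. card (C S))" by (rule card_UN_le[OF finQ])
  finally have YQ: "card Y \<le> (\<Sum>S\<in>Q. card (C S))" .
  have Yne: "card Y > 0" using Ylarge X0 by (cases "card Y") auto
  define c where "c = real (card X) / (card P * 2 ^ card P)"
  have c0: "c > 0" using P0 X0 by (simp add: c_def)
  have "\<exists>S\<in>Q. c \<le> card (C S)"
  proof (rule ccontr)
    assume "\<not> ?thesis"
    then have lt: "\<And>S. S \<in> Q \<Longrightarrow> real (card (C S)) < c" by force
    have Qne: "Q \<noteq> {}" using YQ Yne by auto
    have "real (card Y) \<le> (\<Sum>S\<in>Q. real (card (C S)))"
      using YQ by (metis of_nat_le_iff of_nat_sum)
    also have "\<dots> < (\<Sum>S\<in>Q. c)" by (rule sum_strict_mono[OF finQ Qne lt])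
    also have "\<dots> \<le> 2 ^ card P * c"
    proof -
      have "real (card Q) \<le> 2 ^ card P" using cardQ by (metis of_nat_le_iff of_nat_numeral of_nat_power)
      then show ?thesis using c0 by (simp add: mult_right_mono)
    qed
    finally have "card P * real (card Y) < card P * (2 ^ card P * c)" using P0 by simp
    then show False using Ylarge P0 by (simp add: c_def)
  qed
  then show ?thesis by (auto simp: Q_def C_def c_def)
qed

text \<open>The condition \<open>v \<notin> f\<close> excludes the edges through \<open>v\<close>
  themselves, which also satisfy \<open>insert v f \<in> H\<close>; so links in a
  \<open>(k + 1)\<close>-graph consist of \<open>k\<close>-sets.\<close>

definition vlink :: "'v set set \<Rightarrow> 'v \<Rightarrow> 'v set set" where
  "vlink H v = {f. v \<notin> f \<and> insert v f \<in> H}"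

abbreviation ksubsets :: "nat \<Rightarrow> 'v set \<Rightarrow> 'v set set" where
  "ksubsets k V \<equiv> {f. f \<subseteq> V \<and> card f = k}"

lemma finite_ksubsets: "finite V \<Longrightarrow> finite (ksubsets k V)"
  by (rule finite_subset[of _ "Pow V"]) auto

lemma finite_ksubsets_Collect: "finite V \<Longrightarrow> finite {f. f \<subseteq> V \<and> card f = k \<and> P f}"
  by (rule finite_subset[of _ "Pow V"]) auto

lemma is_rgraph_finite: "is_rgraph r V H \<Longrightarrow> finite H"
  unfolding is_rgraph_def by (rule finite_subset[of _ "Pow V"]) auto

lemma vlink_ksubsets:
  assumes "is_rgraph (Suc k) V H" shows "vlink H v \<subseteq> ksubsets k V"
proof
  fix f assume "f \<in> vlink H v"
  then have "v \<notin> f" and e: "insert v f \<in> H" by (auto simp: vlink_def)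
  then have "insert v f \<subseteq> V" "card (insert v f) = Suc k" "finite V"
    using assms by (auto simp: is_rgraph_def)
  moreover from this have "finite f" by (meson finite_insert finite_subset)
  ultimately show "f \<in> ksubsets k V" using \<open>v \<notin> f\<close> by simp
qed

lemma card_edges_at_le_card_vlink:
  assumes "is_rgraph (Suc k) V H"
  shows "card {e \<in> H. v \<in> e} \<le> card (vlink H v)"
proof (rule surj_card_le)
  have "finite V" using assms by (simp add: is_rgraph_def)
  then show "finite (vlink H v)"
    using finite_subset[OF vlink_ksubsets[OF assms] finite_ksubsets] by blast
  show "{e \<in> H. v \<in> e} \<subseteq> insert v ` vlink H v"
  proof
    fix e assume "e \<in> {e \<in> H. v \<in> e}"
    then have "e = insert v (e - {v})" "e - {v} \<in> vlink H v"
      by (auto simp: vlink_def insert_absorb)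
    then show "e \<in> insert v ` vlink H v" by blast
  qed
qed

lemma binomial_le_double_pred:
  assumes "n \<ge> 2 * k" "n > 0" shows "n choose k \<le> 2 * (n - 1 choose k)"
proof -
  have "(n - k) * (n choose k) = n * (n - 1 choose k)"
    using binomial_absorb_comp[of n k] by simp
  moreover have "n * (n choose k) \<le> 2 * ((n - k) * (n choose k))"
    using assms by (simp only: mult.assoc[symmetric]) (rule mult_right_mono, auto)
  ultimately have "n * (n choose k) \<le> n * (2 * (n - 1 choose k))" by simp
  then show ?thesis using \<open>n > 0\<close> by simp
qed

text \<open>Erdos' theorem. The parts \<open>X i\<close> are disjoint, since every transversal has \<open>k\<close> elements.\<close>
lemma dense_contains_complete_multipartite:
  fixes c :: real
  assumes "N > 0" "c > 0"
  shows "\<exists>n0. \<forall>(V :: 'v set) F. finite V \<longrightarrow> n0 \<le> card V \<longrightarrow> F \<subseteq> ksubsets k V \<longrightarrow>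
    c * (card V choose k) \<le> card F \<longrightarrow>
    (\<exists>X. (\<forall>i<k. X i \<subseteq> V \<and> card (X i) = N) \<and>
      (\<forall>x. (\<forall>i<k. x i \<in> X i) \<longrightarrow> x ` {..<k} \<in> F))"
  using assms(2)
proof (induction k arbitrary: c)
  case 0
  have "{} \<in> F" if "finite V" "F \<subseteq> ksubsets 0 V" "c \<le> card F" for V and F :: "'v set set"
  proof -
    have "F \<noteq> {}" using that 0 by auto
    moreover have "f = {}" if "f \<in> F" for f
    proof -
      have "f \<subseteq> V" "card f = 0" using that \<open>F \<subseteq> ksubsets 0 V\<close> by auto
      then show ?thesis using finite_subset[OF _ \<open>finite V\<close>] by simp
    qed
    ultimately show ?thesis by auto
  qed
  then show ?case by (auto intro!: exI[of _ 0])
next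
  case (Suc k)
  \<comment> \<open>The density falls from \<open>c\<close> to \<open>c / 2\<close> by averaging
    over the vertices and to \<open>c / 4\<close> on replacing \<open>n - 1 choose k\<close> by
    \<open>n choose k\<close>. Thus \<open>m\<close> vertices with links of density
    \<open>c / 4\<close> suffice for \<open>dense_common_intersection\<close>, and \<open>c'\<close>
    is the density that it returns for the induction.\<close>
  define m where "m = Suc (nat \<lceil>4 * real N / c\<rceil>)"
  have m: "real N \<le> c / 4 * m" and m0: "m > 0"
  proof -
    have "4 * real N / c \<le> m" unfolding m_def by linarith
    then show "real N \<le> c / 4 * m" using Suc.prems by (simp add: field_simps)
  qed (simp add: m_def)
  define c' where "c' = 1 / (real m * 2 ^ m)"
  have "c' > 0" using m0 by (simp add: c'_def)
  from Suc.IH[OF this] obtain n1 where n1: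
    "\<And>(V :: 'v set) F. finite V \<Longrightarrow> n1 \<le> card V \<Longrightarrow> F \<subseteq> ksubsets k V \<Longrightarrow>
    c' * (card V choose k) \<le> card F \<Longrightarrow>
    (\<exists>X. (\<forall>i<k. X i \<subseteq> V \<and> card (X i) = N) \<and>
      (\<forall>x. (\<forall>i<k. x i \<in> X i) \<longrightarrow> x ` {..<k} \<in> F))" by blast
  \<comment> \<open>\<open>n1\<close> serves the induction, \<open>2 * k\<close> the comparison of
    the two binomials, and the last summand makes \<open>c / 2 * n\<close> at least
    \<open>m\<close>.\<close>
  define n0 where "n0 = n1 + 2 * k + 1 + nat \<lceil>2 * m / c\<rceil>"
  show ?case
  proof (rule exI[of _ n0], intro allI impI)
    fix V :: "'v set" and F
    assume V: "finite V" "n0 \<le> card V" and F: "F \<subseteq> ksubsets (Suc k) V"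
      and dense: "c * (card V choose Suc k) \<le> card F"
    define n where "n = card V"
    define D where "D = n - 1 choose k"
    have n: "n \<ge> n1" "n \<ge> 2 * k" "n > 0" "n > k" "2 * m / c \<le> n"
    proof -
      have "nat \<lceil>2 * m / c\<rceil> \<le> n" using V(2) unfolding n0_def n_def by linarith
      then show "2 * m / c \<le> n"
        using real_nat_ceiling_ge[of "2 * m / c"] by (meson of_nat_mono order_trans)
    qed (use V(2) in \<open>auto simp: n0_def n_def\<close>)
    have F': "is_rgraph (Suc k) V F" using F V by (auto simp: is_rgraph_def)
    have D0: "D > 0" using n by (simp add: D_def)
    have link_le: "card (vlink F v) \<le> D" if "v \<in> V" for v
    proof -
      have "vlink F v \<subseteq> ksubsets k (V - {v})"
        using vlink_ksubsets[OF F', of v] by (auto simp: vlink_def)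
      then have "card (vlink F v) \<le> card (ksubsets k (V - {v}))"
        by (rule card_mono[rotated]) (use V in \<open>simp add: finite_ksubsets\<close>)
      then show ?thesis using V that by (simp add: n_subsets D_def n_def)
    qed
    \<comment> \<open>The degree sum is at least \<open>c * n * D\<close>. Vertices outside
      \<open>G\<close> contribute at most half of this and those in \<open>G\<close> at most
      \<open>D\<close> each, so \<open>G\<close> has at least \<open>c / 2 * n\<close>
      vertices.\<close>
    define G where "G = {v \<in> V. c / 2 * D \<le> card (vlink F v)}"
    have "c * n * D = c * (n choose Suc k) * Suc k"
    proof -
      have "Suc k * (n choose Suc k) = n * D"
        unfolding D_def by (rule binomial_absorption)
      then have "c * (real (Suc k) * (n choose Suc k)) = c * (real n * D)" by (metis of_nat_mult)
      then show ?thesis by (simp only: mult_ac)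
    qed
    also have "\<dots> \<le> card F * Suc k"
      unfolding of_nat_mult n_def by (rule mult_right_mono[OF dense]) simp
    also have "card F * Suc k = (\<Sum>v\<in>V. card {e \<in> F. v \<in> e})"
    proof -
      have "(\<Sum>v\<in>V. card {e \<in> F. v \<in> e}) = (\<Sum>e\<in>F. card {v \<in> V. v \<in> e})"
        by (rule sum_multicount_gen) (use V is_rgraph_finite[OF F'] in auto)
      also have "\<dots> = (\<Sum>e\<in>F. Suc k)"
      proof (rule sum.cong)
        fix e assume "e \<in> F"
        then have "{v \<in> V. v \<in> e} = e" "card e = Suc k" using F by auto
        then show "card {v \<in> V. v \<in> e} = Suc k" by simp
      qed simp
      finally show ?thesis by simp
    qed
    also have "\<dots> \<le> (\<Sum>v\<in>V. card (vlink F v))"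
      by (rule sum_mono) (rule card_edges_at_le_card_vlink[OF F'])
    finally have "c * n * D \<le> (\<Sum>v\<in>V. real (card (vlink F v)))" by simp
    also have "\<dots> \<le> (\<Sum>v\<in>V. c / 2 * D + (if v \<in> G then real D else 0))"
      using link_le Suc.prems by (intro sum_mono) (force simp: G_def add_increasing)
    also have "\<dots> = c / 2 * D * n + D * real (card G)"
      using \<open>finite V\<close> by (simp add: sum.distrib sum.If_cases G_def Int_def n_def)
    finally have "D * (c / 2 * n) \<le> D * real (card G)" by (simp add: algebra_simps)
    then have "c / 2 * n \<le> card G" using D0 by (simp only: mult_le_cancel_left_pos of_nat_0_less_iff)
    moreover have "m \<le> c / 2 * n" using n(5) Suc.prems by (simp add: field_simps)
    ultimately have "m \<le> card G" by linarith
    then obtain P where P: "P \<subseteq> G" "card P = m" "finite P"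
      by (meson obtain_subset_with_card_n)
    have "\<exists>S\<subseteq>P. card S = N \<and> real (card (ksubsets k V)) / (card P * 2 ^ card P)
        \<le> card {x \<in> ksubsets k V. \<forall>v\<in>S. x \<in> vlink F v}"
    proof (rule dense_common_intersection[where \<delta> = "c / 4"])
      show "P \<noteq> {}" using P m0 by auto
      have "card (ksubsets k V) > 0" using V n by (simp add: n_subsets n_def)
      then show "ksubsets k V \<noteq> {}" by (metis card.empty less_irrefl)
      show "c / 4 * card (ksubsets k V) \<le> card (vlink F v)" if "v \<in> P" for v
      proof -
        have "real (n choose k) \<le> 2 * D"
          using of_nat_mono[OF binomial_le_double_pred[OF n(2,3)], where 'a = real] by (simp add: D_def)
        then have "c / 4 * (n choose k) \<le> c / 2 * D" using Suc.prems by simp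
        then show ?thesis using that P V by (auto simp: n_subsets n_def G_def)
      qed
    qed (use P V m \<open>N > 0\<close> vlink_ksubsets[OF F'] in \<open>auto simp: finite_ksubsets\<close>)
    then obtain S where S: "S \<subseteq> P" "card S = N" and
      com: "c' * (card V choose k) \<le> card {x \<in> ksubsets k V. \<forall>v\<in>S. x \<in> vlink F v}"
      using P V by (auto simp: n_subsets c'_def)
    \<comment> \<open>Adding any vertex of \<open>S\<close> to a member of \<open>K\<close> gives an
      edge, so \<open>S\<close> can serve as the last part.\<close>
    define K where "K = {x \<in> ksubsets k V. \<forall>v\<in>S. x \<in> vlink F v}"
    have "K \<subseteq> ksubsets k V" by (auto simp: K_def)
    from n1[OF \<open>finite V\<close> n(1)[unfolded n_def] this com[folded K_def]] obtain X where
      X: "\<And>i. i < k \<Longrightarrow> X i \<subseteq> V \<and> card (X i) = N" and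
      Xt: "\<And>x. (\<forall>i<k. x i \<in> X i) \<Longrightarrow> x ` {..<k} \<in> K" by blast
    have "x ` {..<Suc k} \<in> F" if "\<forall>i<Suc k. x i \<in> (X(k := S)) i" for x
    proof -
      have "x i \<in> X i" if "i < k" for i
        using that \<open>\<forall>i<Suc k. x i \<in> (X(k := S)) i\<close>[rule_format, of i] by simp
      then have "x ` {..<k} \<in> K" using Xt by blast
      moreover have "x k \<in> S" using that[rule_format, of k] by simp
      ultimately have "x ` {..<k} \<in> vlink F (x k)" by (simp add: K_def)
      then show ?thesis by (simp add: vlink_def lessThan_Suc)
    qed
    moreover have "\<forall>i<Suc k. (X(k := S)) i \<subseteq> V \<and> card ((X(k := S)) i) = N"
      using X S P by (auto simp: G_def less_Suc_eq)
    ultimately show "\<exists>X. (\<forall>i<Suc k. X i \<subseteq> V \<and> card (X i) = N) \<and>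
      (\<forall>x. (\<forall>i<Suc k. x i \<in> X i) \<longrightarrow> x ` {..<Suc k} \<in> F)" by blast
  qed
qed

section \<open>Copies of a partite hypergraph\<close>

text \<open>The first part of \<open>B\<close> goes into \<open>T\<close>, the other
  \<open>j\<close> parts into a complete \<open>j\<close>-partite graph inside the common link of
  \<open>T\<close>. Restricting this link to sets disjoint from \<open>A\<close> keeps the copy off
  \<open>A\<close> outside \<open>T\<close>.\<close>

lemma partite_copy_in_dense_common_link:
  fixes c :: real
  assumes B: "r_partite_rgraph (Suc j) s W BV BE" and "c > 0"
  shows "\<exists>n0. \<forall>(V :: 'v set) H A T. is_rgraph (Suc j) V H \<longrightarrow> n0 \<le> card V \<longrightarrow>
    T \<subseteq> V \<longrightarrow> card T = s 1 \<longrightarrow>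
    c * (card V choose j) \<le> card {f \<in> ksubsets j V. f \<inter> A = {} \<and> (\<forall>v\<in>T. f \<in> vlink H v)} \<longrightarrow>
    (\<exists>f. copy_map BV BE V H f \<and> f ` BV \<subseteq> T \<union> (V - A))"
proof -
  have BV: "BV = (\<Union>i\<in>{1..Suc j}. W i)"
    and W: "\<And>i. i \<in> {1..Suc j} \<Longrightarrow> finite (W i) \<and> card (W i) = s i"
    and Wdisj: "\<And>i i'. i \<in> {1..Suc j} \<Longrightarrow> i' \<in> {1..Suc j} \<Longrightarrow> i \<noteq> i' \<Longrightarrow> W i \<inter> W i' = {}"
    and BE: "\<And>e. e \<in> BE \<Longrightarrow> e \<subseteq> BV \<and> (\<forall>i\<in>{1..Suc j}. card (e \<inter> W i) = 1)"
    using B by (auto simp: r_partite_rgraph_def)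
  have finB: "finite BV" unfolding BV using W by blast
  \<comment> \<open>Every \<open>W i\<close> has to embed into a part of this size; the successor
    makes \<open>N\<close> positive even if \<open>BV\<close> is empty.\<close>
  define N where "N = Suc (card BV)"
  have "N > 0" by (simp add: N_def)
  from dense_contains_complete_multipartite[OF this \<open>c > 0\<close>, where k = j] obtain n0 where n0:
    "\<And>(V :: 'v set) F. finite V \<Longrightarrow> n0 \<le> card V \<Longrightarrow> F \<subseteq> ksubsets j V \<Longrightarrow>
    c * (card V choose j) \<le> card F \<Longrightarrow>
    (\<exists>X. (\<forall>i<j. X i \<subseteq> V \<and> card (X i) = N) \<and>
      (\<forall>x. (\<forall>i<j. x i \<in> X i) \<longrightarrow> x ` {..<j} \<in> F))" by blast
  show ?thesis
  proof (rule exI[of _ n0], intro allI impI)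
    fix V :: "'v set" and H A T
    define F where "F = {f \<in> ksubsets j V. f \<inter> A = {} \<and> (\<forall>v\<in>T. f \<in> vlink H v)}"
    assume H: "is_rgraph (Suc j) V H" and V: "n0 \<le> card V" and T: "T \<subseteq> V" "card T = s 1"
      and "c * (card V choose j) \<le> card {f \<in> ksubsets j V. f \<inter> A = {} \<and> (\<forall>v\<in>T. f \<in> vlink H v)}"
    then have dense: "c * (card V choose j) \<le> card F" by (simp add: F_def)
    have finV: "finite V" using H by (simp add: is_rgraph_def)
    have "F \<subseteq> ksubsets j V" by (auto simp: F_def)
    from n0[OF finV V this dense] obtain X where
      X: "\<And>i. i < j \<Longrightarrow> X i \<subseteq> V \<and> card (X i) = N" and
      Xt: "\<And>x. (\<forall>i<j. x i \<in> X i) \<Longrightarrow> x ` {..<j} \<in> F" by blast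
    have "\<exists>y. y \<in> X i" if "i < j" for i
      using X[OF that] \<open>N > 0\<close> by (metis all_not_in_conv card.empty less_irrefl)
    then obtain x0 where x0: "\<And>i. i < j \<Longrightarrow> x0 i \<in> X i" by metis
    \<comment> \<open>Changing one coordinate of the transversal \<open>x0\<close> puts any vertex
      of \<open>X i\<close> into a member of \<open>F\<close>; such members avoid \<open>A\<close>
      and, being link sets of its vertices, \<open>T\<close>.\<close>
    have XA: "y \<notin> A" and XT: "y \<notin> T" if "i < j" "y \<in> X i" for i y
    proof -
      have "(x0(i := y)) ` {..<j} \<in> F" by (rule Xt) (use x0 that in auto)
      moreover have "y \<in> (x0(i := y)) ` {..<j}" using that by force
      ultimately show "y \<notin> A" "y \<notin> T" by (auto simp: F_def vlink_def)
    qed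
    \<comment> \<open>A common vertex would give a transversal with a repeated entry, whose image
      has fewer than \<open>j\<close> elements.\<close>
    have XX: "X i \<inter> X i' = {}" if "i < j" "i' < j" "i \<noteq> i'" for i i'
    proof (rule ccontr)
      assume "X i \<inter> X i' \<noteq> {}"
      then obtain y where y: "y \<in> X i" "y \<in> X i'" by auto
      let ?x = "x0(i := y, i' := y)"
      have "?x ` {..<j} \<in> F" by (rule Xt) (use x0 that y in auto)
      then have "card (?x ` {..<j}) = card {..<j}" by (simp add: F_def)
      then have "inj_on ?x {..<j}" by (rule eq_card_imp_inj_on[rotated]) simp
      then show False using that by (auto dest: inj_onD[of _ _ i i'])
    qed
    \<comment> \<open>Shift of indices: the parts of \<open>B\<close> are numbered from 1 and the
      first one is sent to \<open>T\<close>, while the parts \<open>X\<close> are numbered from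
      0.\<close>
    define Y where "Y i = (if i = 1 then T else X (i - 2))" for i
    have finT: "finite T" using T finV finite_subset by blast
    have Ydisj: "Y i \<inter> Y i' = {}" if ii': "i \<in> {1..Suc j}" "i' \<in> {1..Suc j}" "i \<noteq> i'" for i i'
    proof -
      have TX: "T \<inter> X i = {}" if "i < j" for i using XT that by blast
      consider "i = 1" "i' - 2 < j" "i' \<noteq> 1" | "i' = 1" "i - 2 < j" "i \<noteq> 1"
        | "i \<noteq> 1" "i' \<noteq> 1" "i - 2 < j" "i' - 2 < j" "i - 2 \<noteq> i' - 2"
        using ii' by force
      then show ?thesis
        using TX[of "i - 2"] TX[of "i' - 2"] XX[of "i - 2" "i' - 2"]
        by cases (simp_all add: Y_def Int_commute)
    qed
    have "\<exists>g. inj_on g (W i) \<and> g ` W i \<subseteq> Y i" if i: "i \<in> {1..Suc j}" for i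
    proof -
      have "card (W i) \<le> card BV" by (rule card_mono) (use finB i BV in auto)
      then have "card (W i) \<le> card (Y i) \<and> finite (Y i)"
        using W[OF i] T finT X[of "i - 2"] i finite_subset[OF _ finV] by (auto simp: Y_def N_def)
      then show ?thesis using card_le_inj W[OF i] by metis
    qed
    then obtain g where g: "\<And>i. i \<in> {1..Suc j} \<Longrightarrow> inj_on (g i) (W i) \<and> g i ` W i \<subseteq> Y i"
      by metis
    have "\<exists>i. i \<in> {1..Suc j} \<and> w \<in> W i" if "w \<in> BV" for w using that BV by auto
    then obtain idx where idx: "\<And>w. w \<in> BV \<Longrightarrow> idx w \<in> {1..Suc j} \<and> w \<in> W (idx w)" by metis
    define f where "f w = g (idx w) w" for w
    have fY: "f w \<in> Y (idx w)" if "w \<in> BV" for w using g idx[OF that] by (auto simp: f_def)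
    have idx_eq: "idx w = i" if "i \<in> {1..Suc j}" "w \<in> W i" for i w
    proof -
      have "w \<in> BV" using that BV by auto
      then show ?thesis using idx Wdisj[OF that(1), of "idx w"] that by blast
    qed
    have "inj_on f BV"
    proof (rule inj_onI)
      fix w w' assume w: "w \<in> BV" "w' \<in> BV" "f w = f w'"
      then have "idx w = idx w'"
        using Ydisj idx fY by (metis disjoint_iff)
      then show "w = w'" using w g idx by (metis f_def inj_onD)
    qed
    moreover have img: "f ` BV \<subseteq> T \<union> (V - A)"
    proof
      fix y assume "y \<in> f ` BV"
      then obtain w where w: "w \<in> BV" "y = f w" by auto
      then have "y \<in> Y (idx w)" "idx w \<in> {1..Suc j}" using fY idx by auto
      show "y \<in> T \<union> (V - A)"
      proof (cases "idx w = 1")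
        case False
        then have "idx w - 2 < j" "y \<in> X (idx w - 2)"
          using \<open>idx w \<in> {1..Suc j}\<close> \<open>y \<in> Y (idx w)\<close> by (auto simp: Y_def)
        then show ?thesis using XA X by blast
      qed (use \<open>y \<in> Y (idx w)\<close> in \<open>simp add: Y_def\<close>)
    qed
    moreover have "f ` e \<in> H" if e: "e \<in> BE" for e
    proof -
      have "\<exists>w. e \<inter> W i = {w}" if "i \<in> {1..Suc j}" for i
        using BE[OF e] that by (meson card_1_singletonE)
      then obtain w where w: "\<And>i. i \<in> {1..Suc j} \<Longrightarrow> e \<inter> W i = {w i}" by metis
      have wY: "f (w i) \<in> Y i" if "i \<in> {1..Suc j}" for i
      proof -
        have "w i \<in> e" "w i \<in> W i" using w[OF that] by auto
        then show ?thesis using fY[of "w i"] idx_eq[OF that] BE[OF e] by auto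
      qed
      have "e = w ` {1..Suc j}"
      proof -
        have "e = (\<Union>i\<in>{1..Suc j}. e \<inter> W i)" using BE[OF e] BV by blast
        then show ?thesis using w by auto
      qed
      moreover have "{1..Suc j} = insert 1 ((\<lambda>i. i + 2) ` {..<j})"
      proof -
        have "i \<in> (\<lambda>i. i + 2) ` {..<j}" if "i \<in> {1..Suc j}" "i \<noteq> 1" for i
          using that by (intro image_eqI[of _ _ "i - 2"]) auto
        then have "{1..Suc j} \<subseteq> insert 1 ((\<lambda>i. i + 2) ` {..<j})" by blast
        then show ?thesis by force
      qed
      ultimately have "f ` e = insert (f (w 1)) ((\<lambda>i. f (w (i + 2))) ` {..<j})"
        by (simp add: image_image)
      moreover have "(\<lambda>i. f (w (i + 2))) ` {..<j} \<in> F"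
      proof (rule Xt, intro allI impI)
        fix i assume "i < j"
        then show "f (w (i + 2)) \<in> X i" using wY[of "i + 2"] by (simp add: Y_def)
      qed
      moreover have "f (w 1) \<in> T" using wY[of 1] by (simp add: Y_def)
      ultimately show "f ` e \<in> H" by (auto simp: F_def vlink_def)
    qed
    ultimately show "\<exists>f. copy_map BV BE V H f \<and> f ` BV \<subseteq> T \<union> (V - A)"
      using T by (auto simp: copy_map_def)
  qed
qed

section \<open>Disjoint copies, covers and extremal numbers\<close>

text \<open>\<open>R\<close> is a pool of special vertices, \<open>U\<close> the set already
  occupied, and \<open>Inv R k\<close> expresses that the pool suffices for \<open>k\<close> more
  copies. Each copy is chosen with \<open>A\<close> equal to the union of \<open>U\<close> and
  \<open>R\<close>, so it takes only \<open>S\<close> out of the pool and leaves the rest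
  available.\<close>

lemma greedy_disjoint_copies:
  fixes Inv :: "'v set \<Rightarrow> nat \<Rightarrow> bool"
  assumes "finite V" "finite BV"
    and step: "\<And>R k A. Inv R (Suc k) \<Longrightarrow> R \<subseteq> V \<Longrightarrow> A \<subseteq> V \<Longrightarrow> card A \<le> a \<Longrightarrow>
      \<exists>S f. S \<subseteq> R \<and> Inv (R - S) k \<and> copy_map BV BE V H f \<and> f ` BV \<subseteq> S \<union> (V - A)"
  shows "Inv R k \<Longrightarrow> R \<subseteq> V \<Longrightarrow> U \<subseteq> V \<Longrightarrow> U \<inter> R = {} \<Longrightarrow> card U + card R + k * card BV \<le> a \<Longrightarrow>
    \<exists>fs. (\<forall>i<k. copy_map BV BE V H (fs i) \<and> fs i ` BV \<inter> U = {}) \<and>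
      (\<forall>i<k. \<forall>i'<k. i \<noteq> i' \<longrightarrow> fs i ` BV \<inter> fs i' ` BV = {})"
proof (induction k arbitrary: R U)
  case (Suc k)
  have fin: "finite R" "finite U" using Suc.prems \<open>finite V\<close> finite_subset by blast+
  have "card (U \<union> R) \<le> a" using Suc.prems(5) card_Un_le[of U R] by simp
  then obtain S f where S: "S \<subseteq> R" "Inv (R - S) k" and f: "copy_map BV BE V H f"
    and img: "f ` BV \<subseteq> S \<union> (V - (U \<union> R))"
    using step[of R k "U \<union> R"] Suc.prems by blast
  have "card (U \<union> f ` BV) \<le> card U + card BV"
    using card_Un_le[of U "f ` BV"] card_image_le[OF \<open>finite BV\<close>, of f] by linarith
  moreover have "card (R - S) \<le> card R" by (rule card_mono) (use fin in auto)
  ultimately have "card (U \<union> f ` BV) + card (R - S) + k * card BV \<le> a"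
    using Suc.prems(5) by simp
  moreover have "U \<union> f ` BV \<subseteq> V" "(U \<union> f ` BV) \<inter> (R - S) = {}" and fU: "f ` BV \<inter> U = {}"
    using Suc.prems S img by blast+
  ultimately obtain fs where
    fs: "\<And>i. i < k \<Longrightarrow> copy_map BV BE V H (fs i) \<and> fs i ` BV \<inter> (U \<union> f ` BV) = {}"
    and disj: "\<And>i i'. i < k \<Longrightarrow> i' < k \<Longrightarrow> i \<noteq> i' \<Longrightarrow> fs i ` BV \<inter> fs i' ` BV = {}"
    using Suc.IH[OF S(2), of "U \<union> f ` BV"] Suc.prems(2) by (metis Diff_subset order_trans)
  show ?case
  proof (intro exI[of _ "fs(k := f)"] conjI allI impI)
    fix i assume "i < Suc k"
    then show "copy_map BV BE V H ((fs(k := f)) i)" "(fs(k := f)) i ` BV \<inter> U = {}"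
      using fs[of i] f fU by (auto simp: less_Suc_eq)
  next
    fix i i' assume "i < Suc k" "i' < Suc k" "i \<noteq> i'"
    then show "(fs(k := f)) i ` BV \<inter> (fs(k := f)) i' ` BV = {}"
      using fs[of i] fs[of i'] disj[of i i'] unfolding less_Suc_eq by (auto; blast)
  qed
qed simp

text \<open>A maximum family of disjoint copies has at most \<open>q\<close> members, and a copy
  avoiding all their vertices would extend it.\<close>

lemma exists_cover_of_copies:
  assumes "finite V" "finite BV" and H: "is_rgraph r V H"
    and no: "\<not> has_disjoint_copies (Suc q) BV BE V H"
  shows "\<exists>U\<subseteq>V. card U \<le> q * card BV \<and>
    (\<forall>f. \<not> copy_map BV BE (V - U) {e \<in> H. e \<inter> U = {}} f)"
proof -
  \<comment> \<open>Leastness of \<open>k\<close> encodes maximality: \<open>k - 1\<close> disjoint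
    copies exist, but \<open>k\<close> do not.\<close>
  define k where "k = (LEAST k. \<not> has_disjoint_copies k BV BE V H)"
  let ?P = "\<lambda>k. \<not> has_disjoint_copies k BV BE V H"
  have k: "\<not> has_disjoint_copies k BV BE V H" "k \<le> Suc q"
    using LeastI[of ?P, OF no] Least_le[of ?P, OF no] by (simp_all add: k_def)
  have "k \<noteq> 0"
  proof
    assume "k = 0"
    then show False using k(1) by (simp add: has_disjoint_copies_def)
  qed
  then obtain p where p: "k = Suc p" by (cases k) auto
  have "has_disjoint_copies p BV BE V H"
    using not_less_Least[of p "\<lambda>k. \<not> has_disjoint_copies k BV BE V H"] p by (simp add: k_def)
  then obtain fs where fs: "\<And>i. i < p \<Longrightarrow> copy_map BV BE V H (fs i)"
    and disj: "\<And>i i'. i < p \<Longrightarrow> i' < p \<Longrightarrow> i \<noteq> i' \<Longrightarrow> fs i ` BV \<inter> fs i' ` BV = {}"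
    unfolding has_disjoint_copies_def by metis
  define U where "U = (\<Union>i<p. fs i ` BV)"
  have "U \<subseteq> V" using fs by (auto simp: U_def copy_map_def)
  moreover have "card U \<le> q * card BV"
  proof -
    have "card U \<le> (\<Sum>i<p. card (fs i ` BV))" unfolding U_def by (rule card_UN_le) simp
    also have "\<dots> \<le> (\<Sum>i<p. card BV)" by (rule sum_mono) (rule card_image_le[OF \<open>finite BV\<close>])
    also have "\<dots> \<le> q * card BV" using k p by simp
    finally show ?thesis .
  qed
  moreover have False if f: "copy_map BV BE (V - U) {e \<in> H. e \<inter> U = {}} f" for f
  proof -
    have fU: "f ` BV \<inter> fs i ` BV = {}" if "i < p" for i
      using f that by (auto simp: copy_map_def U_def)
    have "has_disjoint_copies (Suc p) BV BE V H"
      unfolding has_disjoint_copies_def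
    proof (intro exI[of _ "fs(p := f)"] conjI allI impI)
      fix i assume "i < Suc p"
      then show "copy_map BV BE V H ((fs(p := f)) i)"
        using fs[of i] f by (auto simp: less_Suc_eq copy_map_def)
    next
      fix i i' assume "i < Suc p" "i' < Suc p" "i \<noteq> i'"
      then show "(fs(p := f)) i ` BV \<inter> (fs(p := f)) i' ` BV = {}"
        using fU[of i] fU[of i'] disj[of i i'] unfolding less_Suc_eq by (auto; blast)
    qed
    then show False using k p by simp
  qed
  ultimately show ?thesis by blast
qed

text \<open>Only the edges need to lie in \<open>X\<close>: a copy that uses a new vertex uses it as an isolated
  vertex, which can be moved into \<open>X\<close> as soon as \<open>X\<close> is large enough to accommodate the copy.\<close>
lemma card_le_ex_if_no_copy:
  fixes F :: "'v set set" and BE :: "'a set set"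
  assumes "finite BV" and BE: "\<And>e. e \<in> BE \<Longrightarrow> e \<subseteq> BV" and F: "is_rgraph r X F"
    and nocopy: "\<And>f. \<not> copy_map BV BE X F f"
    and X: "card BV \<le> card X" "card X \<le> m"
  shows "card F \<le> ex r m BV BE"
proof -
  have finX: "finite X" and FX: "\<And>e. e \<in> F \<Longrightarrow> e \<subseteq> X \<and> card e = r"
    using F by (auto simp: is_rgraph_def)
  obtain h where h: "inj_on h X" "h ` X \<subseteq> {..<m}"
    using card_le_inj[of X "{..<m}"] finX X by auto
  have inj: "inj_on (image h) F"
    by (rule inj_on_subset[OF inj_on_image_Pow[OF h(1)]]) (use FX in auto)
  have G: "is_rgraph r {..<m} ((`) h ` F)"
    unfolding is_rgraph_def
  proof (intro conjI ballI)
    fix e assume "e \<in> (`) h ` F"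
    then obtain e' where "e' \<in> F" "e = h ` e'" by auto
    then show "e \<subseteq> {..<m}" "card e = r"
      using FX[of e'] h card_image[OF inj_on_subset[OF h(1), of e']] by auto
  qed simp
  have "\<not> copy_map BV BE {..<m} ((`) h ` F) f" for f
  proof
    assume f: "copy_map BV BE {..<m} ((`) h ` F) f"
    \<comment> \<open>\<open>C\<close> consists of the non-isolated vertices of \<open>B\<close>.
      Their images lie in edges and can be pulled back along \<open>h\<close>; only the others have
      to be moved.\<close>
    define C where "C = \<Union>BE"
    have C: "C \<subseteq> BV" using BE by (auto simp: C_def)
    have fC: "f ` C \<subseteq> h ` X"
    proof
      fix y assume "y \<in> f ` C"
      then obtain e where e: "e \<in> BE" "y \<in> f ` e" by (auto simp: C_def)
      then have "f ` e \<in> (`) h ` F" using f by (auto simp: copy_map_def)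
      then show "y \<in> h ` X" using e FX by blast
    qed
    have finj: "inj_on f C" using f C inj_on_subset by (auto simp: copy_map_def)
    define u where "u w = inv_into X h (f w)" for w
    have u: "h (u w) = f w" "u w \<in> X" if "w \<in> C" for w
      using fC that by (auto simp: u_def f_inv_into_f inv_into_into image_subset_iff)
    have uinj: "inj_on u C"
      using finj u by (auto simp: inj_on_def) metis
    have "card (BV - C) \<le> card (X - u ` C)"
    proof -
      have "finite C" using C \<open>finite BV\<close> finite_subset by blast
      moreover have "u ` C \<subseteq> X" using u by auto
      ultimately show ?thesis
        using C X card_image[OF uinj] by (simp add: card_Diff_subset)
    qed
    then obtain v where v: "inj_on v (BV - C)" "v ` (BV - C) \<subseteq> X - u ` C"
      using card_le_inj[of "BV - C" "X - u ` C"] finX \<open>finite BV\<close> by auto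
    define f' where "f' w = (if w \<in> C then u w else v w)" for w
    have "inj_on f' BV"
    proof (rule inj_onI)
      fix w w' assume "w \<in> BV" "w' \<in> BV" "f' w = f' w'"
      then show "w = w'"
        using v uinj by (auto simp: f'_def inj_on_def split: if_splits)
    qed
    moreover have "f' ` BV \<subseteq> X" using u v by (auto simp: f'_def)
    moreover have "f' ` e \<in> F" if e: "e \<in> BE" for e
    proof -
      have "f ` e \<in> (`) h ` F" using f e by (auto simp: copy_map_def)
      then obtain e' where e': "e' \<in> F" "f ` e = h ` e'" by auto
      have eC: "e \<subseteq> C" using e by (auto simp: C_def)
      have "f' ` e = u ` e" using eC by (auto simp: f'_def)
      moreover have "h ` (u ` e) = f ` e" using u eC by (force simp: image_image)
      moreover have "u ` e \<subseteq> X" "e' \<subseteq> X" using u eC FX[OF e'(1)] by auto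
      ultimately have "f' ` e = e'" using e' inj_on_image_eq_iff[OF h(1)] by metis
      then show ?thesis using e' by simp
    qed
    ultimately show False using nocopy[of f'] by (auto simp: copy_map_def)
  qed
  then have "\<not> has_disjoint_copies 1 BV BE {..<m} ((`) h ` F)"
    by (simp add: has_disjoint_copies_def)
  then have mem: "card F \<in> {card E | E. is_rgraph r {..<m} E \<and> \<not> has_disjoint_copies 1 BV BE {..<m} E}"
    using G card_image[OF inj, symmetric] by blast
  \<comment> \<open>\<open>Sup\<close> on the naturals is guaranteed to be an upper bound only for
    bounded sets.\<close>
  have "bdd_above {card E | E. is_rgraph r {..<m} E \<and> \<not> has_disjoint_copies 1 BV BE {..<m} E}"
  proof (rule bdd_aboveI[of _ "card (Pow {..<m})"])
    fix x assume "x \<in> {card E | E. is_rgraph r {..<m} E \<and> \<not> has_disjoint_copies 1 BV BE {..<m} E}"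
    then obtain E where "x = card E" "E \<subseteq> Pow {..<m}" by (auto simp: is_rgraph_def)
    then show "x \<le> card (Pow {..<m})" by (simp add: card_mono)
  qed
  then show ?thesis unfolding ex_mult_def by (rule cSup_upper[OF mem])
qed

section \<open>Counting edges\<close>

text \<open>Pascal's rule \<open>b\<close> times: each step adds some
  \<open>(m + i) choose j\<close>, which is at least \<open>m choose j\<close>.\<close>

lemma binomial_add_lower:
  "(m choose Suc j) + b * (m choose j) \<le> (m + b) choose Suc j"
proof (induction b)
  case (Suc b)
  have "m choose j \<le> (m + b) choose j" by (rule binomial_right_mono) simp
  then show ?case using Suc by simp
qed simp

text \<open>Union bound: for positive \<open>j\<close> each vertex of \<open>A\<close> lies in a
  fraction \<open>j / card V\<close> of all \<open>j\<close>-sets.\<close>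

lemma card_ksubsets_meeting_le:
  assumes "finite V" "V \<noteq> {}" "A \<subseteq> V"
  shows "real (card {f \<in> ksubsets j V. f \<inter> A \<noteq> {}})
    \<le> real (card A) * j / card V * (card V choose j)"
proof (cases j)
  case 0
  then have "{f \<in> ksubsets j V. f \<inter> A \<noteq> {}} = {}"
    using finite_subset[OF _ \<open>finite V\<close>] by auto
  then show ?thesis by (metis card.empty of_nat_0 of_nat_0_le_iff mult_nonneg_nonneg divide_nonneg_nonneg)
next
  case (Suc i)
  let ?K = "ksubsets j V"
  have K: "is_rgraph (Suc i) V ?K" using assms Suc by (auto simp: is_rgraph_def)
  have finA: "finite A" using assms finite_subset by blast
  have V0: "card V > 0" using assms by (simp add: card_gt_0_iff)
  have each: "card {f \<in> ?K. v \<in> f} \<le> card V - 1 choose i" if "v \<in> A" for v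
  proof -
    have "card {f \<in> ?K. v \<in> f} \<le> card (vlink ?K v)" by (rule card_edges_at_le_card_vlink[OF K])
    also have "\<dots> \<le> card (ksubsets i (V - {v}))"
    proof (rule card_mono)
      show "vlink ?K v \<subseteq> ksubsets i (V - {v})"
        using vlink_ksubsets[OF K, of v] by (auto simp: vlink_def)
    qed (use assms in \<open>simp add: finite_ksubsets\<close>)
    also have "\<dots> = card V - 1 choose i" using assms that by (auto simp: n_subsets)
    finally show ?thesis .
  qed
  have "{f \<in> ?K. f \<inter> A \<noteq> {}} \<subseteq> (\<Union>v\<in>A. {f \<in> ?K. v \<in> f})" by auto
  then have "card {f \<in> ?K. f \<inter> A \<noteq> {}} \<le> card (\<Union>v\<in>A. {f \<in> ?K. v \<in> f})"
    by (rule card_mono[rotated]) (use finA \<open>finite V\<close> in \<open>simp add: finite_ksubsets_Collect\<close>)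
  also have "\<dots> \<le> (\<Sum>v\<in>A. card {f \<in> ?K. v \<in> f})" by (rule card_UN_le[OF finA])
  also have "\<dots> \<le> (\<Sum>v\<in>A. card V - 1 choose i)" by (rule sum_mono) (rule each)
  finally have "card {f \<in> ?K. f \<inter> A \<noteq> {}} \<le> card A * (card V - 1 choose i)" by simp
  then have "real (card {f \<in> ?K. f \<inter> A \<noteq> {}}) \<le> real (card A) * (card V - 1 choose i)"
    by (simp flip: of_nat_mult)
  also have "real (card V - 1 choose i) = real j / card V * (card V choose j)"
  proof -
    have "real j * (card V choose j) = card V * real (card V - 1 choose i)"
      using binomial_absorption[of i "card V"] Suc by (metis of_nat_mult)
    then show ?thesis using V0 by (simp add: field_simps)
  qed
  finally show ?thesis by simp
qed

lemma binomial_diff_lower: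
  assumes "b \<le> n" "n > 0"
  shows "(1 - real b * j / n) * (n choose j) \<le> n - b choose j"
proof -
  let ?V = "{..<n}" and ?A = "{..<b}"
  let ?M = "{f \<in> ksubsets j ?V. f \<inter> ?A \<noteq> {}}"
  have "ksubsets j ?V \<subseteq> ?M \<union> ksubsets j (?V - ?A)" by blast
  then have "card (ksubsets j ?V) \<le> card (?M \<union> ksubsets j (?V - ?A))"
    by (rule card_mono[rotated]) (simp add: finite_ksubsets)
  also have "\<dots> \<le> card ?M + card (ksubsets j (?V - ?A))" by (rule card_Un_le)
  finally have "n choose j \<le> card ?M + (n - b choose j)"
    using assms by (simp add: n_subsets card_Diff_subset)
  then have "real (n choose j) \<le> card ?M + real (n - b choose j)"
    by (simp flip: of_nat_add)
  moreover have "card ?M \<le> real b * j / n * (n choose j)"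
    using card_ksubsets_meeting_le[of ?V ?A j] assms by force
  ultimately show ?thesis by (simp add: algebra_simps)
qed

lemma card_edges_le_avoiding_plus_links:
  assumes "is_rgraph (Suc j) V H" "F \<subseteq> H" "finite Z"
  shows "card F \<le> card {e \<in> F. e \<inter> Z = {}} + (\<Sum>v\<in>Z. card (vlink H v))"
proof -
  have finH: "finite H" by (rule is_rgraph_finite[OF assms(1)])
  then have finF: "finite F" using assms finite_subset by blast
  have "F \<subseteq> {e \<in> F. e \<inter> Z = {}} \<union> (\<Union>v\<in>Z. {e \<in> H. v \<in> e})" using assms by auto
  then have "card F \<le> card ({e \<in> F. e \<inter> Z = {}} \<union> (\<Union>v\<in>Z. {e \<in> H. v \<in> e}))"
    by (rule card_mono[rotated]) (use finF finH assms in auto)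
  also have "\<dots> \<le> card {e \<in> F. e \<inter> Z = {}} + card (\<Union>v\<in>Z. {e \<in> H. v \<in> e})" by (rule card_Un_le)
  also have "card (\<Union>v\<in>Z. {e \<in> H. v \<in> e}) \<le> (\<Sum>v\<in>Z. card {e \<in> H. v \<in> e})"
    by (rule card_UN_le) fact
  also have "\<dots> \<le> (\<Sum>v\<in>Z. card (vlink H v))"
    by (rule sum_mono) (rule card_edges_at_le_card_vlink[OF assms(1)])
  finally show ?thesis by simp
qed

text \<open>The edges meeting \<open>L\<close> and the \<open>r\<close>-subsets of
  \<open>V - L\<close> are disjoint families of \<open>r\<close>-subsets of
  \<open>V\<close>.\<close>

lemma card_edges_meeting_le:
  assumes "is_rgraph r V H" "L \<subseteq> V"
  shows "card {e \<in> H. e \<inter> L \<noteq> {}} + (card V - card L choose r) \<le> card V choose r"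
proof -
  have finV: "finite V" using assms by (simp add: is_rgraph_def)
  have finL: "finite L" using assms finV finite_subset by blast
  have "card {e \<in> H. e \<inter> L \<noteq> {}} + card (ksubsets r (V - L))
    = card ({e \<in> H. e \<inter> L \<noteq> {}} \<union> ksubsets r (V - L))"
    by (rule card_Un_disjoint[symmetric])
      (use is_rgraph_finite[OF assms(1)] finV in \<open>auto simp: finite_ksubsets\<close>)
  also have "\<dots> \<le> card (ksubsets r V)"
    by (rule card_mono) (use assms finV in \<open>auto simp: finite_ksubsets is_rgraph_def\<close>)
  finally show ?thesis using finV finL assms by (simp add: n_subsets card_Diff_subset)
qed

lemma has_disjoint_copies_add:
  fixes fs gs :: "nat \<Rightarrow> 'a \<Rightarrow> 'b"
  assumes fs: "\<And>i. i < k \<Longrightarrow> copy_map BV BE V H (fs i)"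
    and gs: "\<And>i. i < l \<Longrightarrow> copy_map BV BE V H (gs i)"
    and fs_disj: "\<And>i i'. i < k \<Longrightarrow> i' < k \<Longrightarrow> i \<noteq> i' \<Longrightarrow> fs i ` BV \<inter> fs i' ` BV = {}"
    and gs_disj: "\<And>i i'. i < l \<Longrightarrow> i' < l \<Longrightarrow> i \<noteq> i' \<Longrightarrow> gs i ` BV \<inter> gs i' ` BV = {}"
    and cross: "\<And>i i'. i < k \<Longrightarrow> i' < l \<Longrightarrow> fs i ` BV \<inter> gs i' ` BV = {}"
  shows "has_disjoint_copies (k + l) BV BE V H"
  unfolding has_disjoint_copies_def
proof (intro exI[of _ "\<lambda>i. if i < k then fs i else gs (i - k)"] conjI allI impI)
  fix i assume "i < k + l"
  then show "copy_map BV BE V H (if i < k then fs i else gs (i - k))"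
    using fs[of i] gs[of "i - k"] by simp
next
  fix i i' assume "i < k + l" "i' < k + l" "i \<noteq> i'"
  then show "(if i < k then fs i else gs (i - k)) ` BV \<inter> (if i' < k then fs i' else gs (i' - k)) ` BV = {}"
    using fs_disj[of i i'] gs_disj[of "i - k" "i' - k"] cross[of i "i' - k"] cross[of i' "i - k"]
    by (simp add: Int_commute)
qed

section \<open>Hypergraphs with few disjoint copies\<close>

text \<open>The size conditions are those of the theorem with all surplus constant factors dropped.\<close>
locale few_disjoint_copies =
  fixes j s1 t :: nat and BV :: "'a set" and BE :: "'a set set"
    and V :: "'v set" and H :: "'v set set"
  assumes finB: "finite BV" and BE_sub: "\<And>e. e \<in> BE \<Longrightarrow> e \<subseteq> BV"
    and s1_pos: "0 < s1" and s1_le: "s1 \<le> card BV"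
    and H: "is_rgraph (Suc j) V H"
    and few: "\<not> has_disjoint_copies (Suc t) BV BE V H"
    and copy: "\<And>T A. T \<subseteq> V \<Longrightarrow> card T = s1 \<Longrightarrow>
      real (card V choose j) / (64 * (card BV)\<^sup>2 * 2 ^ (64 * (card BV)\<^sup>2)) \<le>
        card {f \<in> ksubsets j V. f \<inter> A = {} \<and> (\<forall>v\<in>T. f \<in> vlink H v)} \<Longrightarrow>
      \<exists>f. copy_map BV BE V H f \<and> f ` BV \<subseteq> T \<union> (V - A)"
    and t_large: "100000 * card BV ^ 3 \<le> t"
    and V_large: "1024 * s1 * card BV ^ 3 * Suc j * t \<le> card V"
    and ex_small: "real (ex (Suc j) (card V) BV BE) \<le> t / (320 * real s1 * card BV) * (card V choose j)"
begin

section \<open>Degree classes and size estimates\<close>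

abbreviation "S \<equiv> card BV"
abbreviation "n \<equiv> card V"
abbreviation "D \<equiv> real (n choose j)"
abbreviation "deg v \<equiv> real (card (vlink H v))"
abbreviation "b \<equiv> s1 * Suc t - 1"

text \<open>Thresholds as fractions of \<open>D\<close>. That of \<open>high\<close> is twice the
  density at which averaging over \<open>64 * S^2\<close> vertices works, which leaves room for
  deletions. That of \<open>heavy\<close> is such that removing \<open>k * S / s1\<close> vertices
  below it costs at most \<open>k * D / 2\<close> edges. A vertex of \<open>full\<close> misses at
  most \<open>D / (4 * S)\<close> sets, so \<open>s1 - 1\<close> of them leave enough of the link of
  a vertex of \<open>heavy\<close>.\<close>

definition high :: "'v set" where "high = {v \<in> V. s1 / (32 * S\<^sup>2) * D \<le> deg v}"
definition heavy :: "'v set" where "heavy = {v \<in> V. s1 / (2 * S) * D \<le> deg v}"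
definition full :: "'v set" where "full = {v \<in> V. (1 - 1 / (4 * S)) * D \<le> deg v}"

lemma S_pos: "0 < S" using s1_pos s1_le by simp

lemma finV: "finite V" using H by (simp add: is_rgraph_def)

lemma t_ge: "100000 * S \<le> t" "100000 * S\<^sup>2 \<le> t" "0 < t"
proof -
  have "S ^ 1 \<le> S ^ 3" "S ^ 2 \<le> S ^ 3" using S_pos by (intro power_increasing; simp)+
  then show "100000 * S \<le> t" "100000 * S\<^sup>2 \<le> t" using t_large by auto
  then show "0 < t" using S_pos by auto
qed

lemma n_ge: "1024 * s1 * S ^ 3 * Suc j * t \<le> n" "1024 * (Suc j) * t * S \<le> n" "Suc j \<le> n" "8 * S * t \<le> n"
proof -
  show 1: "1024 * s1 * S ^ 3 * Suc j * t \<le> n" by (rule V_large)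
  have "S ^ 1 \<le> S ^ 3" using S_pos by (intro power_increasing; simp)
  then have "1 * S \<le> s1 * S ^ 3" using s1_pos by (intro mult_le_mono) auto
  then have "(1024 * Suc j * t) * S \<le> (1024 * Suc j * t) * (s1 * S ^ 3)" by (intro mult_left_mono) auto
  then show 2: "1024 * (Suc j) * t * S \<le> n" using 1 by (simp only: mult_ac)
  have "Suc j * 1 \<le> Suc j * (1024 * t * S)" using t_ge S_pos by (intro mult_left_mono) auto
  then show "Suc j \<le> n" using 2 by (simp only: mult_ac mult_1)
  have "(8 * S * t) * 1 \<le> (8 * S * t) * (128 * Suc j)" by (intro mult_left_mono) auto
  then show "8 * S * t \<le> n" using 2 by (simp only: mult_ac mult_1)
qed

text \<open>While \<open>t + 1\<close> copies are built, the pool and the vertices already used must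
  be avoided; together they stay within the size that \<open>card_meeting_le\<close>
  tolerates.\<close>

lemma pool_and_copies_size: "s1 * Suc t + 64 * S\<^sup>2 + Suc t * S \<le> 4 * S * t"
proof -
  have "s1 * Suc t \<le> S * Suc t" using s1_le by (rule mult_right_mono) simp
  moreover have "S * (100000 * S) \<le> S * t" using t_ge(1) by (rule mult_le_mono2)
  moreover have "S * 1 \<le> S * S" using S_pos by (intro mult_le_mono2) auto
  ultimately show ?thesis by (simp only: power2_eq_square mult_Suc_right mult_Suc mult.commute[of t S])
qed

lemma D_pos: "0 < D" using n_ge(3) by simp

lemma card_ksubsets: "card (ksubsets j V) = n choose j"
  using finV by (simp add: n_subsets)

lemma finite_vlink: "finite (vlink H v)"
  using finite_subset[OF vlink_ksubsets[OF H] finite_ksubsets[OF finV]] .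

lemma deg_le: "deg v \<le> D"
  using card_mono[OF finite_ksubsets[OF finV] vlink_ksubsets[OF H]] by (simp add: card_ksubsets)

lemma card_meeting_le:
  assumes "A \<subseteq> V" "card A \<le> 4 * S * t"
  shows "card {f \<in> ksubsets j V. f \<inter> A \<noteq> {}} \<le> D / (256 * S\<^sup>2)"
proof -
  have n0: "n > 0" using n_ge by linarith
  then have "V \<noteq> {}" by auto
  from card_ksubsets_meeting_le[OF finV this assms(1), of j]
  have "card {f \<in> ksubsets j V. f \<inter> A \<noteq> {}} \<le> real (card A) * j / n * D" .
  also have "\<dots> \<le> 1 / (256 * S\<^sup>2) * D"
  proof (rule mult_right_mono)
    have "256 * S\<^sup>2 * (card A * j) \<le> 256 * S\<^sup>2 * ((4 * S * t) * Suc j)"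
      using assms(2) by (intro mult_le_mono) auto
    also have "\<dots> = 1024 * 1 * S ^ 3 * Suc j * t" by (simp only: power2_eq_square power3_eq_cube) (simp add: algebra_simps)
    also have "\<dots> \<le> 1024 * s1 * S ^ 3 * Suc j * t" using s1_pos by (intro mult_le_mono) auto
    also have "\<dots> \<le> n" by (rule n_ge)
    finally have "real (256 * S\<^sup>2 * (card A * j)) \<le> n" by (simp only: of_nat_le_iff)
    then have "256 * (real S)\<^sup>2 * (card A * j) \<le> n" by simp
    then show "real (card A) * j / n \<le> 1 / (256 * S\<^sup>2)" using n0 S_pos by (simp add: field_simps)
  qed simp
  finally show ?thesis by simp
qed

section \<open>Copies through vertices of large degree\<close>

text \<open>Deleting the sets that meet \<open>A\<close> costs at most half of the degree threshold,
  so links keep density \<open>s1 / (64 * S^2)\<close>. Over \<open>64 * S^2\<close> vertices these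
  densities add up to \<open>s1\<close>, just what averaging needs, and the common link that it
  yields has the density required in \<open>copy\<close>.\<close>

lemma copy_from_high:
  assumes P: "P \<subseteq> high" "64 * S\<^sup>2 \<le> card P" and A: "A \<subseteq> V" "card A \<le> 4 * S * t"
  shows "\<exists>T f. T \<subseteq> P \<and> card T = s1 \<and> copy_map BV BE V H f \<and> f ` BV \<subseteq> T \<union> (V - A)"
proof -
  obtain Q where Q: "Q \<subseteq> P" "card Q = 64 * S\<^sup>2" "finite Q"
    using P(2) by (rule obtain_subset_with_card_n)
  define N where "N v = {f \<in> vlink H v. f \<inter> A = {}}" for v
  have "\<exists>T\<subseteq>Q. card T = s1 \<and> real (card (ksubsets j V)) / (card Q * 2 ^ card Q)
      \<le> card {x \<in> ksubsets j V. \<forall>v\<in>T. x \<in> N v}"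
  proof (rule dense_common_intersection[where \<delta> = "s1 / (64 * S\<^sup>2)"])
    show "Q \<noteq> {}" using Q S_pos by auto
    have "card (ksubsets j V) \<noteq> 0" using D_pos by (simp add: card_ksubsets)
    then show "ksubsets j V \<noteq> {}" by (metis card.empty)
    show "N v \<subseteq> ksubsets j V" for v using vlink_ksubsets[OF H, of v] by (auto simp: N_def)
    show "s1 / (64 * S\<^sup>2) * card (ksubsets j V) \<le> card (N v)" if "v \<in> Q" for v
    proof -
      let ?M = "{f \<in> ksubsets j V. f \<inter> A \<noteq> {}}"
      have "vlink H v \<subseteq> N v \<union> ?M" using vlink_ksubsets[OF H, of v] by (auto simp: N_def)
      then have "card (vlink H v) \<le> card (N v \<union> ?M)"
        by (rule card_mono[rotated]) (simp add: N_def finite_vlink finite_ksubsets_Collect[OF finV])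
      also have "\<dots> \<le> card (N v) + card ?M" by (rule card_Un_le)
      finally have "deg v \<le> card (N v) + real (card ?M)" by (simp flip: of_nat_add)
      also have "card ?M \<le> D / (256 * S\<^sup>2)" by (rule card_meeting_le[OF A])
      also have "D / (256 * S\<^sup>2) \<le> s1 / (64 * S\<^sup>2) * D"
        using s1_pos mult_right_mono[of 1 "4 * real s1" "D / (256 * S\<^sup>2)"] by simp
      finally have "deg v \<le> card (N v) + s1 / (64 * S\<^sup>2) * D" by simp
      moreover have "s1 / (32 * S\<^sup>2) * D \<le> deg v" using that Q P by (auto simp: high_def)
      moreover have "s1 / (32 * S\<^sup>2) * D = 2 * (s1 / (64 * S\<^sup>2) * D)" by simp
      ultimately show ?thesis by (simp only: card_ksubsets)
    qed
    show "real s1 \<le> s1 / (64 * S\<^sup>2) * card Q" using Q S_pos by simp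
  qed (use Q s1_pos finV finite_ksubsets in auto)
  then obtain T where T: "T \<subseteq> Q" "card T = s1" and
    dense: "D / (64 * S\<^sup>2 * 2 ^ (64 * S\<^sup>2)) \<le> card {x \<in> ksubsets j V. \<forall>v\<in>T. x \<in> N v}"
    using Q(2) by (auto simp: card_ksubsets)
  \<comment> \<open>Disjointness from \<open>A\<close> is hidden in membership in
    \<open>N v\<close>, so it needs some \<open>v\<close> in \<open>T\<close>.\<close>
  have "T \<noteq> {}" using T s1_pos by auto
  then have "{x \<in> ksubsets j V. \<forall>v\<in>T. x \<in> N v}
    = {f \<in> ksubsets j V. f \<inter> A = {} \<and> (\<forall>v\<in>T. f \<in> vlink H v)}" by (auto simp: N_def)
  moreover have "T \<subseteq> V" using T Q P by (auto simp: high_def)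
  ultimately have "\<exists>f. copy_map BV BE V H f \<and> f ` BV \<subseteq> T \<union> (V - A)"
    using copy[of T A] T(2) dense by simp
  then obtain f where "copy_map BV BE V H f" "f ` BV \<subseteq> T \<union> (V - A)" by (elim exE conjE)
  moreover have "T \<subseteq> P" using T(1) Q(1) by (rule order_trans)
  ultimately show ?thesis using T(2) by (intro exI conjI)
qed

text \<open>With \<open>y = D / (4 * S)\<close>, the link of \<open>v\<close> has at least
  \<open>2 * s1 * y\<close> sets. The other \<open>s1 - 1\<close> vertices miss at most
  \<open>(s1 - 1) * y\<close> of them and \<open>A\<close> spoils at most \<open>y / 2\<close>, so
  at least \<open>y / 2\<close> remain in the common link.\<close>

lemma copy_from_full:
  assumes T: "T \<subseteq> V" "card T = s1" "v \<in> T" "v \<in> heavy" "T - {v} \<subseteq> full"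
    and A: "A \<subseteq> V" "card A \<le> 4 * S * t"
  shows "\<exists>f. copy_map BV BE V H f \<and> f ` BV \<subseteq> T \<union> (V - A)"
proof -
  let ?K = "ksubsets j V"
  let ?C = "{f \<in> ?K. f \<inter> A = {} \<and> (\<forall>v\<in>T. f \<in> vlink H v)}"
  let ?M = "{f \<in> ?K. f \<inter> A \<noteq> {}}"
  have finT: "finite T" using T finV finite_subset by blast
  have finK: "finite ?K" by (rule finite_ksubsets[OF finV])
  have miss: "real (card (?K - vlink H w)) \<le> D / (4 * S)" if "w \<in> T - {v}" for w
  proof -
    have "(1 - 1 / (4 * S)) * D \<le> deg w" using that T by (auto simp: full_def)
    moreover have "real (card (?K - vlink H w)) = D - deg w"
      using card_Diff_subset[OF finite_vlink vlink_ksubsets[OF H]] deg_le[of w]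
      by (simp add: card_ksubsets of_nat_diff)
    ultimately show ?thesis by (simp add: algebra_simps)
  qed
  have "vlink H v \<subseteq> ?C \<union> ?M \<union> (\<Union>w\<in>T - {v}. ?K - vlink H w)"
    using vlink_ksubsets[OF H, of v] by blast
  then have "card (vlink H v) \<le> card (?C \<union> ?M \<union> (\<Union>w\<in>T - {v}. ?K - vlink H w))"
    by (rule card_mono[rotated]) (use finK finT finV in \<open>simp add: finite_ksubsets_Collect\<close>)
  also have "\<dots> \<le> card ?C + card ?M + card (\<Union>w\<in>T - {v}. ?K - vlink H w)"
    by (meson add_mono card_Un_le order_refl order_trans)
  also have "card (\<Union>w\<in>T - {v}. ?K - vlink H w) \<le> (\<Sum>w\<in>T - {v}. card (?K - vlink H w))"
    by (rule card_UN_le) (use finT in simp)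
  finally have "deg v \<le> real (card ?C) + card ?M + (\<Sum>w\<in>T - {v}. real (card (?K - vlink H w)))"
    by (simp flip: of_nat_sum of_nat_add)
  also have "(\<Sum>w\<in>T - {v}. real (card (?K - vlink H w))) \<le> (\<Sum>w\<in>T - {v}. D / (4 * S))"
    by (rule sum_mono) (rule miss)
  also have "\<dots> = (s1 - 1) * (D / (4 * S))" using T finT by simp
  also have "real (s1 - 1) = real s1 - 1" using s1_pos by simp
  also have "card ?M \<le> D / (256 * S\<^sup>2)" by (rule card_meeting_le[OF A])
  finally have le: "deg v \<le> card ?C + D / (256 * S\<^sup>2) + (real s1 - 1) * (D / (4 * S))" by simp
  define x y c where "x = D / (256 * S\<^sup>2)" and "y = D / (4 * S)" and "c = real (card ?C)"
  have "deg v \<le> c + x + (real s1 * y - y)"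
    using le unfolding x_def y_def c_def by (simp only: left_diff_distrib mult_1)
  moreover have "2 * (real s1 * y) \<le> deg v" using T by (auto simp: heavy_def y_def)
  moreover have "x \<le> y / 2"
    using S_pos D_pos by (simp add: x_def y_def field_simps power2_eq_square)
  moreover have "1 * y \<le> real s1 * y"
    using s1_pos by (intro mult_right_mono) (auto simp: y_def)
  ultimately have "y / 2 \<le> c" by linarith
  then have "D / (4 * S) / 2 \<le> card ?C" by (simp only: y_def c_def)
  moreover have "D / (64 * S\<^sup>2 * 2 ^ (64 * S\<^sup>2)) \<le> D / (4 * S) / 2"
  proof -
    have "8 * real S \<le> 64 * S\<^sup>2 * 2 ^ (64 * S\<^sup>2)"
    proof -
      have "8 * real S * 1 \<le> 64 * (real S)\<^sup>2 * 2 ^ (64 * S\<^sup>2)"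
        using S_pos by (intro mult_mono) (auto simp: power2_eq_square)
      then show ?thesis by simp
    qed
    then have "D / (64 * S\<^sup>2 * 2 ^ (64 * S\<^sup>2)) \<le> D / (8 * S)"
      using S_pos by (intro divide_left_mono) auto
    then show ?thesis by simp
  qed
  ultimately show ?thesis using copy[of T A] T by simp
qed

lemma full_subset_heavy: "full \<subseteq> heavy"
proof -
  have "s1 / (2 * S) \<le> 1 - 1 / (4 * real S)" using s1_le S_pos by (simp add: field_simps)
  then have "s1 / (2 * S) * D \<le> (1 - 1 / (4 * real S)) * D" by (rule mult_right_mono) simp
  then show ?thesis by (auto simp: full_def heavy_def)
qed

lemma heavy_subset_high: "heavy \<subseteq> high"
proof -
  have "s1 / (32 * S\<^sup>2) \<le> s1 / (2 * real S)"
    using S_pos by (intro divide_left_mono) (auto simp: power2_eq_square)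
  then have "s1 / (32 * S\<^sup>2) * D \<le> s1 / (2 * real S) * D" by (rule mult_right_mono) simp
  then show ?thesis by (auto simp: high_def heavy_def)
qed

lemma classes_subset: "full \<subseteq> V" "heavy \<subseteq> V" "high \<subseteq> V"
  by (auto simp: full_def heavy_def high_def)

lemma finite_classes: "finite full" "finite heavy" "finite high"
  using classes_subset finV finite_subset by blast+

text \<open>Each copy uses up \<open>s1\<close> vertices of the pool, so a pool of this size still
  has \<open>64 * S^2\<close> vertices available for each of \<open>t + 1\<close> copies.\<close>

lemma card_high: "card high < s1 * Suc t + 64 * S\<^sup>2"
proof (rule ccontr)
  assume "\<not> ?thesis"
  then have "s1 * Suc t + 64 * S\<^sup>2 \<le> card high" by simp
  then obtain R where R: "R \<subseteq> high" "card R = s1 * Suc t + 64 * S\<^sup>2"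
    by (rule obtain_subset_with_card_n)
  define Inv where "Inv R k \<longleftrightarrow> R \<subseteq> high \<and> s1 * k + 64 * S\<^sup>2 \<le> card R" for R k
  have "\<exists>fs. (\<forall>i<Suc t. copy_map BV BE V H (fs i) \<and> fs i ` BV \<inter> {} = {}) \<and>
      (\<forall>i<Suc t. \<forall>i'<Suc t. i \<noteq> i' \<longrightarrow> fs i ` BV \<inter> fs i' ` BV = {})"
  proof (rule greedy_disjoint_copies[of V BV Inv "4 * S * t" BE H R "Suc t" "{}", OF finV finB])
    fix R k A assume I: "Inv R (Suc k)" and A: "A \<subseteq> V" "card A \<le> 4 * S * t"
    then have "R \<subseteq> high" "64 * S\<^sup>2 \<le> card R" by (auto simp: Inv_def)
    from copy_from_high[OF this A] obtain T f where
      T: "T \<subseteq> R" "card T = s1" and f: "copy_map BV BE V H f" "f ` BV \<subseteq> T \<union> (V - A)" by blast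
    have "finite T" using T s1_pos card_ge_0_finite by blast
    then have "card (R - T) = card R - s1" using T by (simp add: card_Diff_subset)
    then have "Inv (R - T) k" using I by (auto simp: Inv_def)
    then show "\<exists>T f. T \<subseteq> R \<and> Inv (R - T) k \<and> copy_map BV BE V H f \<and> f ` BV \<subseteq> T \<union> (V - A)"
      using T f by blast
  next
    show "card {} + card R + Suc t * S \<le> 4 * S * t" using R pool_and_copies_size by simp
  qed (use R classes_subset in \<open>auto simp: Inv_def\<close>)
  then show False using few by (auto simp: has_disjoint_copies_def)
qed

text \<open>As long as at least \<open>64 S\<^sup>2\<close> pool vertices outside \<open>full\<close> remain, averaging supplies the
  next copy from them; afterwards each of the remaining ones is completed by vertices of \<open>full\<close>.\<close>
lemma disjoint_copies_from_heavy:
  assumes R: "R \<subseteq> heavy" and U: "U \<subseteq> V" "U \<inter> R = {}" and k: "s1 * k \<le> card R"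
    and full: "(s1 - 1) * (64 * S\<^sup>2) \<le> card (R \<inter> full)"
    and small: "card U + card R + k * S \<le> 4 * S * t"
  shows "\<exists>fs. (\<forall>i<k. copy_map BV BE V H (fs i) \<and> fs i ` BV \<inter> U = {}) \<and>
      (\<forall>i<k. \<forall>i'<k. i \<noteq> i' \<longrightarrow> fs i ` BV \<inter> fs i' ` BV = {})"
proof -
  \<comment> \<open>For each of the at most \<open>64 * S^2\<close> vertices that averaging may
    leave over, \<open>s1 - 1\<close> vertices of \<open>full\<close> are reserved. Averaging takes
    nothing from \<open>full\<close>; once fewer than \<open>64 * S^2\<close> vertices outside
    \<open>full\<close> remain, finishing one of them lowers both sides by
    \<open>s1 - 1\<close>.\<close>
  define Inv where "Inv R k \<longleftrightarrow> R \<subseteq> heavy \<and> s1 * k \<le> card R \<and>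
    (s1 - 1) * min (card (R - full)) (64 * S\<^sup>2) \<le> card (R \<inter> full)" for R k
  show ?thesis
  proof (rule greedy_disjoint_copies[of V BV Inv "4 * S * t" BE H R k U, OF finV finB])
    fix R k A assume I: "Inv R (Suc k)" and A: "A \<subseteq> V" "card A \<le> 4 * S * t"
    from I have Rt: "R \<subseteq> heavy" and Rk: "s1 + s1 * k \<le> card R"
      and Rf: "(s1 - 1) * min (card (R - full)) (64 * S\<^sup>2) \<le> card (R \<inter> full)"
      by (auto simp: Inv_def)
    have finR: "finite R" using Rt finite_classes finite_subset by blast
    have finish: "\<exists>T f. T \<subseteq> R \<and> Inv (R - T) k \<and> copy_map BV BE V H f \<and> f ` BV \<subseteq> T \<union> (V - A)"
      if T: "T \<subseteq> R" "card T = s1"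
        "(s1 - 1) * min (card (R - T - full)) (64 * S\<^sup>2) \<le> card ((R - T) \<inter> full)"
        and f: "copy_map BV BE V H f" "f ` BV \<subseteq> T \<union> (V - A)" for T f
    proof -
      have "finite T" using T finR finite_subset by blast
      then have "card (R - T) = card R - s1" using T by (simp add: card_Diff_subset)
      then have "Inv (R - T) k" using Rt Rk T by (auto simp: Inv_def)
      then show ?thesis using T f by blast
    qed
    consider (many) "64 * S\<^sup>2 \<le> card (R - full)"
      | (few) "card (R - full) < 64 * S\<^sup>2" "R - full \<noteq> {}" | (none) "R \<subseteq> full" by force
    then show "\<exists>T f. T \<subseteq> R \<and> Inv (R - T) k \<and> copy_map BV BE V H f \<and> f ` BV \<subseteq> T \<union> (V - A)"
    proof cases
      case many
      have "R - full \<subseteq> high" using Rt heavy_subset_high by blast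
      from copy_from_high[OF this many A] obtain T f where T: "T \<subseteq> R - full" "card T = s1"
        and f: "copy_map BV BE V H f" "f ` BV \<subseteq> T \<union> (V - A)" by blast
      have "(s1 - 1) * min (card (R - T - full)) (64 * S\<^sup>2) \<le> (s1 - 1) * min (card (R - full)) (64 * S\<^sup>2)"
        using many by (intro mult_le_mono2) simp
      also note Rf
      also have "R \<inter> full = (R - T) \<inter> full" using T by blast
      finally show ?thesis using finish[of T f] T f by blast
    next
      case few
      then obtain v where v: "v \<in> R" "v \<notin> full" by blast
      define M where "M = card (R - full)"
      have M: "M > 0" "min (card (R - full)) (64 * S\<^sup>2) = M"
        using few finR by (auto simp: M_def card_gt_0_iff)
      have G: "(s1 - 1) * M \<le> card (R \<inter> full)" using Rf M by simp
      have "s1 - 1 \<le> (s1 - 1) * M" using M by simp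
      then have "s1 - 1 \<le> card (R \<inter> full)" using G by linarith
      then obtain Q where Q: "Q \<subseteq> R \<inter> full" "card Q = s1 - 1" "finite Q"
        by (rule obtain_subset_with_card_n)
      define T where "T = insert v Q"
      have T: "T \<subseteq> R" "v \<in> T" "T - {v} \<subseteq> full" using Q v by (auto simp: T_def)
      have "v \<notin> Q" using Q v by blast
      then have cT: "card T = s1" using Q s1_pos by (simp add: T_def)
      have "T \<subseteq> V" using T Rt classes_subset by blast
      from copy_from_full[OF this cT T(2) _ T(3) A] v Rt obtain f where
        f: "copy_map BV BE V H f" "f ` BV \<subseteq> T \<union> (V - A)" by blast
      have "R - T - full = (R - full) - {v}" using Q v by (auto simp: T_def)
      then have c1: "card (R - T - full) = M - 1" using finR v by (simp add: M_def)
      have "(R - T) \<inter> full = R \<inter> full - Q" using v by (auto simp: T_def)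
      then have c2: "card ((R - T) \<inter> full) = card (R \<inter> full) - (s1 - 1)"
        using Q by (simp add: card_Diff_subset)
      have "(s1 - 1) * min (card (R - T - full)) (64 * S\<^sup>2) \<le> (s1 - 1) * (M - 1)"
        unfolding c1 by (intro mult_le_mono2) simp
      also have "\<dots> = (s1 - 1) * M - (s1 - 1)" by (simp add: diff_mult_distrib2)
      also have "\<dots> \<le> card ((R - T) \<inter> full)" unfolding c2 using G by (rule diff_le_mono)
      finally show ?thesis using finish[of T f] T cT f by blast
    next
      case none
      have "s1 \<le> card R" using Rk by simp
      then obtain T where T: "T \<subseteq> R" "card T = s1" by (rule obtain_subset_with_card_n)
      then obtain v where v: "v \<in> T" using s1_pos by fastforce
      have TT: "T \<subseteq> V" "v \<in> heavy" "T - {v} \<subseteq> full" using T v none full_subset_heavy classes_subset by blast+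
      from copy_from_full[OF TT(1) T(2) v TT(2,3) A] obtain f where
        f: "copy_map BV BE V H f" "f ` BV \<subseteq> T \<union> (V - A)" by blast
      have "R - T - full = {}" using none by blast
      then have "(s1 - 1) * min (card (R - T - full)) (64 * S\<^sup>2) \<le> card ((R - T) \<inter> full)"
        by (simp only: card.empty min_0L mult_0_right le0)
      then show ?thesis using finish[of T f] T f by blast
    qed
  next
    have "(s1 - 1) * min (card (R - full)) (64 * S\<^sup>2) \<le> (s1 - 1) * (64 * S\<^sup>2)"
      by (intro mult_le_mono2) simp
    also note full
    finally show "Inv R k" unfolding Inv_def using R k by blast
  qed (use R U small classes_subset in auto)
qed

section \<open>Edge counts and the bound for one hypergraph\<close>

lemma b_bounds: "s1 * t \<le> b" "b \<le> 2 * S * t" "b \<le> n"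
proof -
  have "s1 * t + s1 = s1 * Suc t" by simp
  then show "s1 * t \<le> b" using s1_pos by linarith
  have "s1 * Suc t \<le> S * Suc t" using s1_le by (rule mult_right_mono) simp
  moreover have "S * Suc t \<le> S * (2 * t)" using t_ge by (intro mult_le_mono2) simp
  ultimately show "b \<le> 2 * S * t" by (simp only: mult_ac)
  then show "b \<le> n" using n_ge(4) by linarith
qed

text \<open>Removing \<open>b\<close> vertices loses at most a fraction \<open>b * j / n\<close> of
  the \<open>j\<close>-sets, and \<open>b\<close> is at most \<open>2 * s1 * t\<close>. The first
  form gives the density assumed in \<open>many_full\<close>, the second pays for deletions in
  \<open>card_le_if_many_full\<close>.\<close>

lemma choose_lower: "(1 - 1 / (512 * real S ^ 3)) * D \<le> n - b choose j" "D / 2 \<le> n - b choose j"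
proof -
  have n0: "n > 0" using n_ge by linarith
  have "512 * S ^ 3 * (b * j) \<le> 512 * S ^ 3 * ((2 * s1 * t) * Suc j)"
  proof (intro mult_le_mono)
    have "s1 * Suc t \<le> s1 * (2 * t)" using t_ge by (intro mult_le_mono2) simp
    then show "b \<le> 2 * s1 * t" by (simp only: mult_ac)
  qed auto
  also have "\<dots> = 1024 * s1 * S ^ 3 * Suc j * t" by (simp add: algebra_simps)
  also have "\<dots> \<le> n" by (rule n_ge)
  finally have "real (512 * S ^ 3 * (b * j)) \<le> n" by (simp only: of_nat_le_iff)
  then have "512 * real S ^ 3 * (real b * j) \<le> n" by (simp only: of_nat_mult of_nat_power of_nat_numeral)
  then have "real b * j / n \<le> 1 / (512 * real S ^ 3)" using n0 S_pos by (simp add: field_simps)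
  then have "(1 - 1 / (512 * real S ^ 3)) * D \<le> (1 - real b * j / n) * D"
    by (intro mult_right_mono) auto
  also have "\<dots> \<le> n - b choose j" by (rule binomial_diff_lower[OF b_bounds(3) n0])
  finally show 1: "(1 - 1 / (512 * real S ^ 3)) * D \<le> n - b choose j" .
  have "1 / (512 * real S ^ 3) \<le> 1 / 2"
  proof -
    have "1 \<le> real S ^ 3" using S_pos by (intro one_le_power) simp
    then have "1 / (512 * real S ^ 3) \<le> 1 / (512 * 1)" using S_pos by (intro divide_left_mono) auto
    then show ?thesis by simp
  qed
  then have "1 / 2 * D \<le> (1 - 1 / (512 * real S ^ 3)) * D" by (intro mult_right_mono) auto
  then show "D / 2 \<le> n - b choose j" using 1 by simp
qed

text \<open>All but \<open>ex\<close> many edges meet a cover of at most \<open>t * S\<close>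
  vertices, and the cover vertices outside \<open>high\<close> have small degree. So nearly all
  edges come from the roughly \<open>s1 * t\<close> vertices of \<open>high\<close>; if few were in
  \<open>full\<close>, each of the others would lose a fraction \<open>1 / (4 * S)\<close>, more
  than the assumed density permits.\<close>

lemma many_full:
  assumes dense: "real (s1 * t) * ((1 - 1 / (512 * real S ^ 3)) * D) \<le> card H"
  shows "(s1 - 1) * (64 * S\<^sup>2) \<le> card full"
proof (rule ccontr)
  assume "\<not> ?thesis"
  moreover have "(s1 - 1) * (64 * S\<^sup>2) \<le> s1 * (64 * S\<^sup>2)" by (intro mult_le_mono1) simp
  ultimately have "card full \<le> s1 * (64 * S\<^sup>2)" by linarith
  then have "real (card full) \<le> real (s1 * (64 * S\<^sup>2))" by (simp only: of_nat_le_iff)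
  then have cfull: "card full \<le> real s1 * (64 * (real S)\<^sup>2)" by simp
  from exists_cover_of_copies[OF finV finB H few] obtain U where U: "U \<subseteq> V" "card U \<le> t * S"
    and nocopy: "\<And>f. \<not> copy_map BV BE (V - U) {e \<in> H. e \<inter> U = {}} f" by blast
  have finU: "finite U" using U finV finite_subset by blast
  have "t * S + S \<le> n"
  proof -
    have "S * 1 \<le> S * t" using t_ge by (intro mult_le_mono2) simp
    then show ?thesis using n_ge(4) by (simp only: mult.commute[of t S])
  qed
  then have "S \<le> card (V - U)" using U finU by (simp add: card_Diff_subset)
  moreover have "card (V - U) \<le> n" using finV by (intro card_mono) auto
  moreover have "is_rgraph (Suc j) (V - U) {e \<in> H. e \<inter> U = {}}" using H by (auto simp: is_rgraph_def)
  ultimately have exU: "card {e \<in> H. e \<inter> U = {}} \<le> ex (Suc j) n BV BE"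
    using card_le_ex_if_no_copy[OF finB BE_sub] nocopy by blast
  define Z where "Z = high \<union> (U - high)"
  have finZ: "finite Z" using finU finite_classes by (simp add: Z_def)
  have "card {e \<in> H. e \<inter> Z = {}} \<le> card {e \<in> H. e \<inter> U = {}}"
    by (rule card_mono) (use is_rgraph_finite[OF H] in \<open>auto simp: Z_def\<close>)
  with card_edges_le_avoiding_plus_links[OF H order_refl finZ] exU
  have "card H \<le> ex (Suc j) n BV BE + (\<Sum>v\<in>Z. card (vlink H v))" by linarith
  also have "(\<Sum>v\<in>Z. card (vlink H v)) = (\<Sum>v\<in>high. card (vlink H v)) + (\<Sum>v\<in>U - high. card (vlink H v))"
    unfolding Z_def by (rule sum.union_disjoint) (use finU finite_classes in auto)
  finally have "real (card H) \<le> ex (Suc j) n BV BE + ((\<Sum>v\<in>high. deg v) + (\<Sum>v\<in>U - high. deg v))"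
    by (simp flip: of_nat_sum of_nat_add)
  \<comment> \<open>Adding a whole \<open>D\<close> for vertices of \<open>full\<close> overcounts,
    harmlessly, since \<open>full\<close> is assumed to be small here.\<close>
  also have "(\<Sum>v\<in>high. deg v) \<le> (\<Sum>v\<in>high. (1 - 1 / (4 * S)) * D + (if v \<in> full then D else 0))"
  proof (rule sum_mono)
    fix v assume "v \<in> high"
    have "0 \<le> (1 - 1 / (4 * S)) * D" using S_pos by (intro mult_nonneg_nonneg) (auto simp: field_simps)
    then show "deg v \<le> (1 - 1 / (4 * S)) * D + (if v \<in> full then D else 0)"
      using deg_le[of v] classes_subset \<open>v \<in> high\<close> by (auto simp: full_def)
  qed
  also have "\<dots> = card high * ((1 - 1 / (4 * S)) * D) + card full * D"
  proof -
    have "high \<inter> full = full" using full_subset_heavy heavy_subset_high by blast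
    then show ?thesis using finite_classes by (simp add: sum.distrib sum.If_cases)
  qed
  also have "\<dots> \<le> (s1 * t + s1 + 64 * (real S)\<^sup>2) * ((1 - 1 / (4 * S)) * D) + s1 * (64 * (real S)\<^sup>2) * D"
  proof (intro add_mono mult_right_mono)
    have "real (card high) \<le> real (s1 * Suc t + 64 * S\<^sup>2)" using card_high by (simp only: of_nat_le_iff)
    then show "real (card high) \<le> s1 * t + s1 + 64 * (real S)\<^sup>2" by (simp add: algebra_simps)
    show "0 \<le> (1 - 1 / (4 * S)) * D" using S_pos by (intro mult_nonneg_nonneg) (auto simp: field_simps)
  qed (use cfull in auto)
  also have "(\<Sum>v\<in>U - high. deg v) \<le> (\<Sum>v\<in>U - high. s1 / (32 * S\<^sup>2) * D)"
    by (rule sum_mono) (use U in \<open>auto simp: high_def\<close>)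
  also have "\<dots> \<le> real (t * S) * (s1 / (32 * S\<^sup>2) * D)"
  proof -
    have "card (U - high) \<le> t * S" using U(2) card_mono[of U "U - high"] finU by simp
    then have "real (card (U - high)) \<le> real (t * S)" by (simp only: of_nat_le_iff)
    then have "real (card (U - high)) * (s1 / (32 * S\<^sup>2) * D) \<le> real (t * S) * (s1 / (32 * S\<^sup>2) * D)"
      by (rule mult_right_mono) simp
    then show ?thesis by simp
  qed
  finally have "real (card H) \<le> ex (Suc j) n BV BE
      + ((s1 * t + s1 + 64 * (real S)\<^sup>2) * ((1 - 1 / (4 * S)) * D) + s1 * (64 * (real S)\<^sup>2) * D
      + real (t * S) * (s1 / (32 * S\<^sup>2) * D))" by simp
  also have "\<dots> \<le> t / (320 * real s1 * S) * D
      + ((s1 * t + s1 + 64 * (real S)\<^sup>2) * ((1 - 1 / (4 * S)) * D) + s1 * (64 * (real S)\<^sup>2) * D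
      + real (t * S) * (s1 / (32 * S\<^sup>2) * D))" using ex_small by simp
  finally have "real (s1 * t) * ((1 - 1 / (512 * real S ^ 3)) * D) \<le> \<dots>" using dense by linarith
  then have "(real (s1 * t) * (1 - 1 / (512 * real S ^ 3))) * D \<le> (t / (320 * real s1 * S)
      + ((s1 * t + s1 + 64 * (real S)\<^sup>2) * (1 - 1 / (4 * S)) + s1 * (64 * (real S)\<^sup>2)
      + real (t * S) * (s1 / (32 * S\<^sup>2)))) * D" by (simp only: distrib_right mult.assoc)
  then have main: "real (s1 * t) * (1 - 1 / (512 * real S ^ 3)) \<le> t / (320 * real s1 * S)
      + ((s1 * t + s1 + 64 * (real S)\<^sup>2) * (1 - 1 / (4 * S)) + s1 * (64 * (real S)\<^sup>2)
      + real (t * S) * (s1 / (32 * S\<^sup>2)))" using D_pos by (simp only: mult_le_cancel_right_pos)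
  \<comment> \<open>\<open>z\<close> is the unit of comparison: the deficit is \<open>z / 4\<close>,
    while the error terms are \<open>z / 512\<close>, \<open>z / 320\<close>, \<open>z / 32\<close>
    and \<open>129 * s1 * S^2\<close>, the last being tiny because \<open>t\<close> is at least
    \<open>100000 * S ^ 3\<close>.\<close>
  define z where "z = real s1 * (real t / S)"
  have S1: "1 \<le> real S" and s11: "1 \<le> real s1" using S_pos s1_pos by auto
  have z0: "z > 0" using s1_pos S_pos t_ge by (simp add: z_def)
  have e1: "real (s1 * t) * (1 - 1 / (512 * real S ^ 3)) \<ge> s1 * t - z / 512"
  proof -
    have "real t / (512 * real S ^ 3) \<le> real t / (512 * S)"
      using S1 by (intro divide_left_mono) (auto simp: self_le_power)
    then have "real s1 * (real t / (512 * real S ^ 3)) \<le> real s1 * (real t / (512 * S))"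
      by (rule mult_left_mono) simp
    then show ?thesis by (simp add: z_def right_diff_distrib)
  qed
  have e2: "t / (320 * real s1 * S) \<le> z / 320"
  proof -
    have "t / (320 * real s1 * S) = real t / S / 320 / s1" by simp
    also have "\<dots> \<le> real t / S / 320 / 1" using s11 by (intro divide_left_mono) auto
    also have "\<dots> = real t / S / 320 * 1" by simp
    also have "\<dots> \<le> real t / S / 320 * s1" using s11 by (intro mult_left_mono) auto
    finally show ?thesis by (simp add: z_def mult.commute)
  qed
  have SS: "100000 * (s1 * (real S)\<^sup>2) \<le> z"
  proof -
    have "real (100000 * S ^ 3) \<le> real t" using t_large by (simp only: of_nat_le_iff)
    then have "100000 * (real S)\<^sup>2 \<le> real t / S"
      using S1 by (simp add: field_simps power2_eq_square power3_eq_cube)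
    then have "real s1 * (100000 * (real S)\<^sup>2) \<le> z" unfolding z_def by (rule mult_left_mono) simp
    then show ?thesis by simp
  qed
  have e3: "(s1 * t + s1 + 64 * (real S)\<^sup>2) * (1 - 1 / (4 * S)) \<le> s1 * t - z / 4 + 65 * (s1 * (real S)\<^sup>2)"
  proof -
    have split: "(s1 * t + s1 + 64 * (real S)\<^sup>2) * (1 - 1 / (4 * S))
      = s1 * t - z / 4 + (s1 + 64 * (real S)\<^sup>2) * (1 - 1 / (4 * S))"
      by (simp add: z_def algebra_simps)
    have "real s1 * 1 \<le> s1 * (real S)\<^sup>2" using S1 by (intro mult_left_mono) auto
    moreover have "1 * (real S)\<^sup>2 \<le> s1 * (real S)\<^sup>2" using s11 by (intro mult_right_mono) auto
    ultimately have "(s1 + 64 * (real S)\<^sup>2) * 1 \<le> 65 * (s1 * (real S)\<^sup>2)" by simp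
    moreover have "(s1 + 64 * (real S)\<^sup>2) * (1 - 1 / (4 * S)) \<le> (s1 + 64 * (real S)\<^sup>2) * 1"
      by (intro mult_left_mono) auto
    ultimately have "(s1 + 64 * (real S)\<^sup>2) * (1 - 1 / (4 * S)) \<le> 65 * (s1 * (real S)\<^sup>2)"
      by (rule order_trans[rotated])
    then show ?thesis unfolding split by (rule add_left_mono)
  qed
  have e4: "real (t * S) * (s1 / (32 * S\<^sup>2)) = z / 32"
    using S1 by (simp add: z_def power2_eq_square mult_ac)
  note e1
  also note main
  also have "t / (320 * real s1 * S)
      + ((s1 * t + s1 + 64 * (real S)\<^sup>2) * (1 - 1 / (4 * S)) + s1 * (64 * (real S)\<^sup>2)
      + real (t * S) * (s1 / (32 * S\<^sup>2)))
    \<le> z / 320 + (s1 * t - z / 4 + 65 * (s1 * (real S)\<^sup>2) + s1 * (64 * (real S)\<^sup>2) + z / 32)"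
    by (rule add_mono[OF e2 add_mono[OF add_mono[OF e3 order_refl] eq_refl[OF e4]]])
  finally show False using SS z0 by simp
qed

text \<open>Since \<open>b + 1 = s1 * Suc t\<close>, one more vertex would allow a pool of that
  size, chosen to contain enough vertices of \<open>full\<close>, to be split among
  \<open>t + 1\<close> copies.\<close>

lemma card_heavy: assumes full: "(s1 - 1) * (64 * S\<^sup>2) \<le> card full" shows "card heavy \<le> b"
proof (rule ccontr)
  assume "\<not> card heavy \<le> b"
  then have big: "s1 * Suc t \<le> card heavy" by linarith
  obtain F where F: "F \<subseteq> full" "card F = (s1 - 1) * (64 * S\<^sup>2)"
    using full by (rule obtain_subset_with_card_n)
  have "(s1 - 1) * (64 * S\<^sup>2) \<le> s1 * Suc t" using t_ge(2) by (intro mult_le_mono) auto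
  then obtain R where R: "F \<subseteq> R" "R \<subseteq> heavy" "card R = s1 * Suc t"
    using exists_subset_between[of F "s1 * Suc t" heavy] F full_subset_heavy big finite_classes by auto
  have "finite R" using R finite_classes finite_subset by blast
  then have "card F \<le> card (R \<inter> full)" using F R by (intro card_mono) auto
  then have "\<exists>fs. (\<forall>i<Suc t. copy_map BV BE V H (fs i) \<and> fs i ` BV \<inter> {} = {}) \<and>
      (\<forall>i<Suc t. \<forall>i'<Suc t. i \<noteq> i' \<longrightarrow> fs i ` BV \<inter> fs i' ` BV = {})"
    using R F pool_and_copies_size by (intro disjoint_copies_from_heavy) auto
  then show False using few by (auto simp: has_disjoint_copies_def)
qed

text \<open>\<open>heavy\<close> falls short of \<open>b\<close> by \<open>k\<close> vertices.
  Outside it at most \<open>q\<close> disjoint copies exist, since \<open>q + 1\<close> of them and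
  \<open>t - q\<close> copies through \<open>heavy\<close> would be too many. Destroying them costs
  at most \<open>k * D / 2\<close> edges, which the gap between \<open>n - l choose Suc j\<close>
  and \<open>n - b choose Suc j\<close> covers.\<close>

lemma card_le_if_many_full:
  assumes full: "(s1 - 1) * (64 * S\<^sup>2) \<le> card full"
  shows "card H + (n - b choose Suc j) \<le> (n choose Suc j) + ex (Suc j) (n - b) BV BE"
proof -
  define l where "l = card heavy"
  define k where "k = b - l"
  define q where "q = k div s1"
  define H' where "H' = {e \<in> H. e \<inter> heavy = {}}"
  have lb: "l \<le> b" unfolding l_def by (rule card_heavy[OF full])
  have qk: "s1 * q \<le> k" "k < s1 * q + s1"
  proof -
    have "k = s1 * q + k mod s1" unfolding q_def by simp
    then show "s1 * q \<le> k" "k < s1 * q + s1" using mod_less_divisor[OF s1_pos, of k] by linarith+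
  qed
  have st: "s1 * Suc t = s1 * t + s1" by simp
  have qt: "q \<le> t"
  proof (rule ccontr)
    assume "\<not> q \<le> t"
    then have "s1 * Suc t \<le> s1 * q" by (intro mult_le_mono2) simp
    then show False using qk(1) s1_pos st by (simp add: k_def)
  qed
  have H': "is_rgraph (Suc j) (V - heavy) H'" using H by (auto simp: is_rgraph_def H'_def)
  have "\<not> has_disjoint_copies (Suc q) BV BE (V - heavy) H'"
  proof
    assume "has_disjoint_copies (Suc q) BV BE (V - heavy) H'"
    then obtain gs where gs: "\<And>i. i < Suc q \<Longrightarrow> copy_map BV BE (V - heavy) H' (gs i)"
      and gs_disj: "\<And>i i'. i < Suc q \<Longrightarrow> i' < Suc q \<Longrightarrow> i \<noteq> i' \<Longrightarrow> gs i ` BV \<inter> gs i' ` BV = {}"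
      unfolding has_disjoint_copies_def by metis
    define U where "U = (\<Union>i<Suc q. gs i ` BV)"
    have U: "U \<subseteq> V - heavy" unfolding U_def using gs by (fastforce simp: copy_map_def)
    have "card U \<le> (\<Sum>i<Suc q. card (gs i ` BV))" unfolding U_def by (rule card_UN_le) simp
    also have "\<dots> \<le> (\<Sum>i<Suc q. S)" by (rule sum_mono) (rule card_image_le[OF finB])
    finally have cU: "card U \<le> Suc q * S" by simp
    have "\<exists>fs. (\<forall>i<t - q. copy_map BV BE V H (fs i) \<and> fs i ` BV \<inter> U = {}) \<and>
      (\<forall>i<t - q. \<forall>i'<t - q. i \<noteq> i' \<longrightarrow> fs i ` BV \<inter> fs i' ` BV = {})"
    proof (rule disjoint_copies_from_heavy[of heavy])
      \<comment> \<open>From \<open>b = s1 * t + s1 - 1\<close> and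
        \<open>k \<le> s1 * q + s1 - 1\<close> follows \<open>l = b - k \<ge> s1 * (t - q)\<close>;
        the two off-by-one terms cancel.\<close>
      have "s1 * (t - q) = s1 * t - s1 * q" by (simp add: diff_mult_distrib2)
      then show "s1 * (t - q) \<le> card heavy" using qk(2) st lb unfolding k_def l_def by linarith
      have "heavy \<inter> full = full" using full_subset_heavy by blast
      then show "(s1 - 1) * (64 * S\<^sup>2) \<le> card (heavy \<inter> full)" using full by simp
      have "Suc q * S + (t - q) * S = Suc t * S" using qt by (simp flip: distrib_right)
      then show "card U + card heavy + (t - q) * S \<le> 4 * S * t"
        using cU lb pool_and_copies_size unfolding l_def by linarith
    qed (use U in auto)
    then obtain fs where fs: "\<And>i. i < t - q \<Longrightarrow> copy_map BV BE V H (fs i) \<and> fs i ` BV \<inter> U = {}"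
      and fs_disj: "\<And>i i'. i < t - q \<Longrightarrow> i' < t - q \<Longrightarrow> i \<noteq> i' \<Longrightarrow> fs i ` BV \<inter> fs i' ` BV = {}"
      by metis
    have "has_disjoint_copies (t - q + Suc q) BV BE V H"
    proof (rule has_disjoint_copies_add[of _ _ _ _ _ fs _ gs])
      show "copy_map BV BE V H (gs i)" if "i < Suc q" for i
        using gs[OF that] by (auto simp: copy_map_def H'_def)
      show "fs i ` BV \<inter> gs i' ` BV = {}" if "i < t - q" "i' < Suc q" for i i'
      proof -
        have "gs i' ` BV \<subseteq> U" using that unfolding U_def by blast
        then show ?thesis using fs[OF that(1)] by blast
      qed
    qed (use fs fs_disj gs_disj in auto)
    then show False using few qt by simp
  qed
  from exists_cover_of_copies[OF _ finB H' this] finV obtain U where U: "U \<subseteq> V - heavy" "card U \<le> q * S"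
    and nocopy: "\<And>f. \<not> copy_map BV BE (V - heavy - U) {e \<in> H'. e \<inter> U = {}} f" by blast
  have cheavy: "card (V - heavy) = n - l" using classes_subset finite_classes by (simp add: card_Diff_subset l_def)
  \<comment> \<open>\<open>q * S\<close> vertices suffice to destroy all copies; at least
    \<open>k\<close> are deleted so that no more than \<open>n - b\<close> vertices remain.\<close>
  define m where "m = max (q * S) k"
  have mb: "m \<le> 2 * S * t"
  proof -
    have "q * S \<le> 2 * t * S" using qt by (intro mult_le_mono1) simp
    then have "q * S \<le> 2 * S * t" by (simp only: mult_ac)
    moreover have "k \<le> 2 * S * t" using b_bounds(2) unfolding k_def by linarith
    ultimately show ?thesis unfolding m_def by (rule max.boundedI)
  qed
  have S_le: "S \<le> S * t" using t_ge by simp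
  \<comment> \<open>At least \<open>S\<close> vertices have to remain, as
    \<open>card_le_ex_if_no_copy\<close> must have room for a copy.\<close>
  have room: "m + S \<le> n - l" using mb lb b_bounds(2) n_ge(4) S_le by linarith
  then obtain U' where U': "U \<subseteq> U'" "U' \<subseteq> V - heavy" "card U' = m"
  proof -
    have "card U \<le> m" "m \<le> card (V - heavy)" using U(2) room cheavy by (auto simp: m_def)
    then show ?thesis using exists_subset_between[of U m "V - heavy"] U(1) finV that by blast
  qed
  have finU': "finite U'" using U' finV finite_subset by blast
  define X where "X = V - heavy - U'"
  define F where "F = {e \<in> H'. e \<inter> U' = {}}"
  have cX: "card X = n - l - m" using U' finU' cheavy by (simp add: X_def card_Diff_subset)
  have "card F \<le> ex (Suc j) (n - b) BV BE"
  proof (rule card_le_ex_if_no_copy[OF finB BE_sub])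
    show "is_rgraph (Suc j) X F" using H' by (auto simp: is_rgraph_def F_def X_def)
    show "\<not> copy_map BV BE X F f" for f
    proof
      assume "copy_map BV BE X F f"
      then have "copy_map BV BE (V - heavy - U) {e \<in> H'. e \<inter> U = {}} f"
        using U'(1) unfolding copy_map_def X_def F_def by blast
      then show False using nocopy by blast
    qed
    show "S \<le> card X" using room cX by linarith
    have "k \<le> m" by (simp add: m_def)
    then show "card X \<le> n - b" using cX lb by (simp add: k_def)
  qed
  moreover have "card H' \<le> card F + (\<Sum>v\<in>U'. card (vlink H v))"
    unfolding F_def by (rule card_edges_le_avoiding_plus_links[OF H _ finU']) (auto simp: H'_def)
  moreover have "card H \<le> card {e \<in> H. e \<inter> heavy \<noteq> {}} + card H'"
  proof -
    have "H = {e \<in> H. e \<inter> heavy \<noteq> {}} \<union> H'" by (auto simp: H'_def)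
    then show ?thesis using card_Un_le by metis
  qed
  moreover have "card {e \<in> H. e \<inter> heavy \<noteq> {}} + (n - l choose Suc j) \<le> n choose Suc j"
    unfolding l_def by (rule card_edges_meeting_le[OF H classes_subset(2)])
  moreover have "(n - b choose Suc j) + k * (n - b choose j) \<le> n - l choose Suc j"
  proof -
    have "n - b + k = n - l" using lb b_bounds(3) by (simp add: k_def)
    then show ?thesis using binomial_add_lower[of "n - b" j k] by simp
  qed
  moreover have "(\<Sum>v\<in>U'. card (vlink H v)) \<le> k * (n - b choose j)"
  proof -
    have "(\<Sum>v\<in>U'. deg v) \<le> (\<Sum>v\<in>U'. s1 / (2 * S) * D)"
      by (rule sum_mono) (use U' in \<open>auto simp: heavy_def\<close>)
    also have "\<dots> = real (m * s1) * (D / (2 * S))" using U' by simp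
    also have "\<dots> \<le> real (k * S) * (D / (2 * S))"
    proof (rule mult_right_mono)
      \<comment> \<open>Both candidates for \<open>m\<close> satisfy
        \<open>m * s1 \<le> k * S\<close>, because \<open>s1 * q \<le> k\<close> and
        \<open>s1 \<le> S\<close>.\<close>
      have "q * S * s1 \<le> k * S" using mult_le_mono1[OF qk(1), of S] by (simp only: mult_ac)
      moreover have "k * s1 \<le> k * S" using s1_le by (rule mult_le_mono2)
      ultimately have "m * s1 \<le> k * S" by (simp add: m_def max_def)
      then show "real (m * s1) \<le> real (k * S)" by (simp only: of_nat_le_iff)
    qed simp
    also have "\<dots> = k * (D / 2)" using S_pos by simp
    also have "\<dots> \<le> k * real (n - b choose j)" by (rule mult_left_mono[OF choose_lower(2)]) simp
    finally have "real (\<Sum>v\<in>U'. card (vlink H v)) \<le> real (k * (n - b choose j))" by simp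
    then show ?thesis by (simp only: of_nat_le_iff)
  qed
  ultimately show ?thesis by linarith
qed

text \<open>A counterexample has at least \<open>b * (n - b choose j)\<close> edges, hence the
  density that \<open>many_full\<close> needs, and then \<open>card_le_if_many_full\<close> refutes
  it. The sums on both sides avoid truncated subtraction.\<close>

lemma card_le:
  "card H + (n - b choose Suc j) \<le> (n choose Suc j) + ex (Suc j) (n - b) BV BE"
proof (rule ccontr)
  assume neg: "\<not> ?thesis"
  have "(n - b choose Suc j) + b * (n - b choose j) \<le> n choose Suc j"
    using binomial_add_lower[of "n - b" j b] b_bounds(3) by simp
  then have "b * (n - b choose j) \<le> card H" using neg by linarith
  moreover have "s1 * t * (n - b choose j) \<le> b * (n - b choose j)" by (rule mult_le_mono1[OF b_bounds(1)])
  ultimately have "real (s1 * t * (n - b choose j)) \<le> card H" by (simp only: of_nat_le_iff)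
  moreover have "real (s1 * t) * ((1 - 1 / (512 * real S ^ 3)) * D) \<le> real (s1 * t) * (n - b choose j)"
    by (rule mult_left_mono[OF choose_lower(1)]) simp
  ultimately have "real (s1 * t) * ((1 - 1 / (512 * real S ^ 3)) * D) \<le> card H" by simp
  from card_le_if_many_full[OF many_full[OF this]] show False using neg by simp
qed

end

section \<open>From the numerical hypotheses to the theorem\<close>

text \<open>Uses only \<open>exp 1 \<ge> 2\<close> and \<open>fact r \<ge> r\<close>, with
  \<open>320 * 320 \<ge> 100000\<close> and \<open>512 * 2 = 1024\<close>. The constant summand of
  the lower bound on \<open>t\<close> gives the first claim, its quotient the third.\<close>

lemma simplified_size_conditions:
  fixes n t r s1 S x :: nat
  assumes "1 \<le> s1" "1 \<le> S" "1 \<le> r"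
    and lower: "320 * exp 1 * real s1 * real S * (real x / real ((n - 1) choose (r - 1))
          + 320 * exp 1 * real s1 * real S ^ 2 * fact r) \<le> real t"
    and upper: "real t \<le> real n / (512 * exp 1 * real s1 * real S ^ 3 * fact r)"
  shows "100000 * S ^ 3 \<le> t" "1024 * s1 * S ^ 3 * r * t \<le> n"
    "real x \<le> t / (320 * real s1 * S) * (n choose (r - 1))"
proof -
  have e: "2 \<le> exp (1::real)" using exp_ge_add_one_self[of 1] by simp
  have fact: "1 \<le> (fact r :: real)" "real r \<le> fact r"
    using fact_ge_self[of r] of_nat_mono[of r "fact r", where 'a = real] by (simp_all add: fact_ge_1)
  let ?q = "real x / real ((n - 1) choose (r - 1))"
  have q0: "0 \<le> ?q" by simp
  have s1: "1 \<le> real s1" and S: "1 \<le> real S" using assms by auto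
  have "320 * 1 * 1 * real S \<le> 320 * exp 1 * real s1 * real S"
    using e s1 S by (intro mult_mono) auto
  moreover have "320 * 1 * 1 * real S ^ 2 * 1 \<le> 320 * exp 1 * real s1 * real S ^ 2 * fact r"
    using e s1 S fact by (intro mult_mono) auto
  then have "320 * real S ^ 2 \<le> ?q + 320 * exp 1 * real s1 * real S ^ 2 * fact r"
    using add_mono[OF q0, of "320 * 1 * 1 * real S ^ 2 * 1"] by simp
  ultimately have "(320 * 1 * 1 * real S) * (320 * real S ^ 2) \<le> 320 * exp 1 * real s1 * real S *
    (?q + 320 * exp 1 * real s1 * real S ^ 2 * fact r)"
    using S s1 by (intro mult_mono) auto
  also note lower
  finally have "102400 * real S ^ 3 \<le> t" by (simp add: power2_eq_square power3_eq_cube mult_ac)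
  moreover have "0 \<le> real S ^ 3" by simp
  ultimately have "real (100000 * S ^ 3) \<le> real t" unfolding of_nat_mult of_nat_power of_nat_numeral by linarith
  then show t: "100000 * S ^ 3 \<le> t" by (simp only: of_nat_le_iff)
  then have t0: "0 < t" using assms(2) by (metis gr0I le_zero_eq mult_is_0 not_one_le_zero power_eq_0_iff zero_neq_numeral)
  have pos: "0 < 512 * exp 1 * real s1 * real S ^ 3 * fact r" using s1 S by simp
  have "(512 * 2) * real s1 * real S ^ 3 * real r \<le> 512 * exp 1 * real s1 * real S ^ 3 * fact r"
    using e s1 S fact by (intro mult_mono) auto
  then have "(512 * 2) * real s1 * real S ^ 3 * real r * t \<le> (512 * exp 1 * real s1 * real S ^ 3 * fact r) * t"
    by (rule mult_right_mono) simp
  also have "\<dots> \<le> n" using upper pos by (simp add: pos_le_divide_eq mult_ac)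
  finally have "real (1024 * s1 * S ^ 3 * r * t) \<le> real n" by simp
  then show n: "1024 * s1 * S ^ 3 * r * t \<le> n" by (simp only: of_nat_le_iff)
  \<comment> \<open>\<open>r \<le> n\<close> makes the binomial in the denominator nonzero;
    otherwise the quotient would be 0 by convention and say nothing about \<open>x\<close>.\<close>
  have "r * 1 \<le> r * (1024 * s1 * S ^ 3 * t)" using t0 assms by (intro mult_le_mono2) (simp add: Suc_le_eq)
  also have "\<dots> = 1024 * s1 * S ^ 3 * r * t" by (simp only: mult_ac)
  also note n
  finally have "r \<le> n" by simp
  then have C0: "0 < real ((n - 1) choose (r - 1))" using assms(3) by simp
  have Cn: "real ((n - 1) choose (r - 1)) \<le> n choose (r - 1)" by (simp add: binomial_right_mono)
  have "320 * real s1 * real S * ?q \<le> 320 * exp 1 * real s1 * real S * (?q + 320 * exp 1 * real s1 * real S ^ 2 * fact r)"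
    using e by (intro mult_mono) auto
  also note lower
  finally have "?q \<le> t / (320 * real s1 * S)" using s1 S by (simp add: pos_le_divide_eq mult_ac)
  then have "?q * real ((n - 1) choose (r - 1)) \<le> t / (320 * real s1 * S) * (n choose (r - 1))"
    using Cn by (intro mult_mono) auto
  then show "real x \<le> t / (320 * real s1 * S) * (n choose (r - 1))" using C0 by simp
qed

text \<open>Includes the empty set, whose \<open>Sup\<close> is 0, for the case that no hypergraph
  avoids the copies.\<close>

lemma Sup_nat_le:
  fixes A :: "nat set"
  assumes "\<And>x. x \<in> A \<Longrightarrow> x \<le> y" shows "Sup A \<le> y"
proof (cases "A = {}")
  case False
  then show ?thesis using assms by (rule cSup_least)
qed (simp add: Sup_nat_def)

theorem theorem1p11:
  fixes r :: nat and s :: "nat \<Rightarrow> nat" and W :: "nat \<Rightarrow> 'a set"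
    and V :: "'a set" and E :: "'a set set"
  assumes "r \<ge> 2"
    and "s 1 \<ge> 2"
    and "\<And>i. 1 \<le> i \<Longrightarrow> i < r \<Longrightarrow> s i \<le> s (Suc i)"
    and "r_partite_rgraph r s W V E"
  shows "\<exists>n0. \<forall>n\<ge>n0. \<forall>t::nat.
     (let S = real (\<Sum>i=1..r. s i) in
       320 * exp 1 * real (s 1) * S *
         (real (ex r n V E) / real ((n - 1) choose (r - 1))
          + 320 * exp 1 * real (s 1) * S ^ 2 * fact r) \<le> real t
       \<and> real t \<le> real n / (512 * exp 1 * real (s 1) * S ^ 3 * fact r))
     \<longrightarrow> int (ex_mult r n (t + 1) V E)
         \<le> int (n choose r) - int ((n - s 1 * (t + 1) + 1) choose r)
           + int (ex r (n - s 1 * (t + 1) + 1) V E)"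
proof -
  obtain j where r: "r = Suc j" using assms(1) by (cases r) auto
  have V: "V = (\<Union>i\<in>{1..r}. W i)"
    and W: "\<forall>i\<in>{1..r}. finite (W i) \<and> card (W i) = s i"
    and disj: "\<forall>i\<in>{1..r}. \<forall>i'\<in>{1..r}. i \<noteq> i' \<longrightarrow> W i \<inter> W i' = {}"
    and E: "\<And>e. e \<in> E \<Longrightarrow> e \<subseteq> V"
    using assms(4) unfolding r_partite_rgraph_def by blast+
  have finV: "finite V" using V W by auto
  have "card V = (\<Sum>i=1..r. card (W i))"
    unfolding V by (rule card_UN_disjoint) (use W disj in auto)
  then have S: "(\<Sum>i=1..r. s i) = card V" using W by simp
  have s1_le: "s 1 \<le> card V"
    using member_le_sum[of 1 "{1..r}" s] assms(1) unfolding S by simp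
  \<comment> \<open>The density of the common link that averaging over \<open>64 * S^2\<close>
    vertices guarantees, as in the locale assumption \<open>copy\<close>.\<close>
  define c where "c = 1 / (64 * (real (card V))\<^sup>2 * 2 ^ (64 * (card V)\<^sup>2))"
  have "c > 0" using s1_le assms(2) by (simp add: c_def)
  from partite_copy_in_dense_common_link[OF assms(4)[unfolded r] this, where 'v = nat] obtain n0 where n0:
    "\<forall>(X :: nat set) H A T. is_rgraph (Suc j) X H \<longrightarrow> n0 \<le> card X \<longrightarrow> T \<subseteq> X \<longrightarrow> card T = s 1 \<longrightarrow>
    c * (card X choose j) \<le> card {f \<in> ksubsets j X. f \<inter> A = {} \<and> (\<forall>v\<in>T. f \<in> vlink H v)} \<longrightarrow>
    (\<exists>f. copy_map V E X H f \<and> f ` V \<subseteq> T \<union> (X - A))" by (elim exE)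
  have main: "int (ex_mult r n (t + 1) V E)
      \<le> int (n choose r) - int ((n - s 1 * (t + 1) + 1) choose r) + int (ex r (n - s 1 * (t + 1) + 1) V E)"
    if n: "n0 \<le> n"
      and lower: "320 * exp 1 * real (s 1) * real (card V) * (real (ex r n V E) / real ((n - 1) choose (r - 1))
          + 320 * exp 1 * real (s 1) * real (card V) ^ 2 * fact r) \<le> real t"
      and upper: "real t \<le> real n / (512 * exp 1 * real (s 1) * real (card V) ^ 3 * fact r)"
    for n t
  proof -
    have "1 \<le> s 1" "1 \<le> card V" "1 \<le> r" using assms s1_le by auto
    note hyps = simplified_size_conditions[OF this lower upper]
    define b where "b = s 1 * Suc t - 1"
    define N where "N = (n choose r) - (n - b choose r) + ex r (n - b) V E"
    have le: "(n - b choose r) \<le> n choose r" by (rule binomial_right_mono) simp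
    have bound: "card H + (n - b choose r) \<le> (n choose r) + ex r (n - b) V E"
      if H: "is_rgraph r {..<n} H" and no: "\<not> has_disjoint_copies (t + 1) V E {..<n} H" for H
    proof -
      interpret few_disjoint_copies j "s 1" t V E "{..<n}" H
      proof
        show "\<exists>f. copy_map V E {..<n} H f \<and> f ` V \<subseteq> T \<union> ({..<n} - A)"
          if "T \<subseteq> {..<n}" "card T = s 1"
            "real (card {..<n} choose j) / (64 * (card V)\<^sup>2 * 2 ^ (64 * (card V)\<^sup>2)) \<le>
            card {f \<in> ksubsets j {..<n}. f \<inter> A = {} \<and> (\<forall>v\<in>T. f \<in> vlink H v)}" for T A
          using n0[rule_format, OF H[unfolded r], of T A] n that by (simp add: c_def)
      qed (use finV E s1_le assms(2) H no hyps r in auto)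
      show "card H + (n - b choose r) \<le> (n choose r) + ex r (n - b) V E"
        using card_le by (simp add: r b_def)
    qed
    have "ex_mult r n (t + 1) V E \<le> N"
      unfolding ex_mult_def
    proof (rule Sup_nat_le)
      fix x assume "x \<in> {card H | H. is_rgraph r {..<n} H \<and> \<not> has_disjoint_copies (t + 1) V E {..<n} H}"
      then obtain H where "x = card H" "is_rgraph r {..<n} H" "\<not> has_disjoint_copies (t + 1) V E {..<n} H"
        by blast
      then show "x \<le> N" using bound[of H] le unfolding N_def by linarith
    qed
    \<comment> \<open>With truncated subtraction this needs \<open>s 1 * (t + 1) \<le> n\<close>,
      which follows from the upper bound on \<open>t\<close>.\<close>
    moreover have "n - s 1 * (t + 1) + 1 = n - b"
    proof -
      have "0 < card V ^ 3" using \<open>1 \<le> card V\<close> by simp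
      then have "0 < t" using hyps(1) by linarith
      then have "s 1 * (t + 1) \<le> s 1 * (2 * t)" by (intro mult_le_mono2) simp
      also have "\<dots> \<le> s 1 * ((1024 * (card V ^ 3 * r)) * t)"
      proof -
        have "1 \<le> card V ^ 3 * r" using \<open>0 < card V ^ 3\<close> \<open>1 \<le> r\<close> by simp
        then show ?thesis by (intro mult_le_mono2 mult_le_mono1) linarith
      qed
      also have "\<dots> = 1024 * s 1 * card V ^ 3 * r * t" by (simp only: mult_ac)
      finally have "s 1 * (t + 1) \<le> n" using hyps(2) by (rule order_trans)
      moreover have "0 < s 1 * (t + 1)" using \<open>1 \<le> s 1\<close> by simp
      ultimately show ?thesis unfolding b_def Suc_eq_plus1 by linarith
    qed
    ultimately show ?thesis using le by (simp add: N_def)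
  qed
  show ?thesis
  proof (intro exI[of _ n0] allI impI)
    fix n t
    assume "n0 \<le> n" and "let S = real (\<Sum>i=1..r. s i) in
       320 * exp 1 * real (s 1) * S *
         (real (ex r n V E) / real ((n - 1) choose (r - 1))
          + 320 * exp 1 * real (s 1) * S ^ 2 * fact r) \<le> real t
       \<and> real t \<le> real n / (512 * exp 1 * real (s 1) * S ^ 3 * fact r)"
    then show "int (ex_mult r n (t + 1) V E)
         \<le> int (n choose r) - int ((n - s 1 * (t + 1) + 1) choose r)
           + int (ex r (n - s 1 * (t + 1) + 1) V E)"
      unfolding S Let_def by (elim conjE) (rule main)
  qed
qed

end
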